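(* Fix $j\in\{1,\dots,m\}$ and let $d^2_{\min}:=\max\{1,r_1,\dots,r_m,\ell_j\}$. Let $(\overline{\mathrm{Q}}_d)$ and $(\underline{\mathrm{Q}}_d)$ be the semidefinite programs defined in the context, with optimal values $\overline{\rho}_{j,d}$ and $\underline{\rho}_{j,d}$ respectively. If $(\overline{\mathrm{Q}}_d)$ (resp. $(\underline{\mathrm{Q}}_d)$) has a feasible solution for each $d\ge d^2_{\min}$, then it has an optimal solution $\mathbf{u}^d=(u^d_{\alpha,k})$ (resp. $\mathbf{w}^d=(w^d_{\alpha,k})$). In addition, $$\lim_{d\to\infty}u^d_{\alpha,1}=\lim_{d\to\infty}w^d_{\alpha,1}=\int_{\Omega_j}\mathbf{x}^\alpha\,d\sigma_j\qquad\forall\alpha\in\mathbb{N}^n.$$ In particular, $\overline{\rho}_{j,d}=u^d_{0,1}\downarrow\sigma_j(\Omega)$ and $\underline{\rho}_{j,d}=w^d_{0,1}\uparrow\sigma_j(\Omega)$ as $d\to\infty$.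
   Context: Setting. Let $\Omega=\{\mathbf{x}\in\mathbb{R}^n: g_j(\mathbf{x})\le b_j,\ j=1,\dots,m\}$ be compact, where each $g_j\in\mathbb{R}[\mathbf{x}]$ is a homogeneous polynomial of degree $d_j$. Assume $\Omega\subset(-1,1)^n$. Let $\Omega_j:=\{\mathbf{x}\in\Omega: g_j(\mathbf{x})=b_j\}$, so that $\partial\Omega=\bigcup_{j=1}^m\Omega_j$, and assume $\nabla g_j(\mathbf{x})\ne0$ for all $\mathbf{x}\in\Omega_j$, $j=1,\dots,m$. Let $\sigma$ be the $(n-1)$-dimensional Hausdorff measure on $\partial\Omega$ and $\sigma_j$ its restriction to $\Omega_j$. Assume $\sigma_j(\{\mathbf{x}: g_k(\mathbf{x})=b_k\})=0$ for all $k\ne j$. Define the measure $\phi_j$ on $\Omega_j$ by $d\phi_j(\mathbf{x})=d\sigma_j(\mathbf{x})/\|\nabla g_j(\mathbf{x})\|$, and let $v_{j,\alpha}=\int_{\Omega_j}\mathbf{x}^\alpha\,d\phi_j$, $\alpha\in\mathbb{N}^n$, be its moments. Notation. $r_j:=\lceil d_j/2\rceil$; $\theta_j(\mathbf{x},z):=z^2-\|\nabla g_j(\mathbf{x})\|^2\in\mathbb{R}[\mathbf{x},z]$; $\ell_j:=\deg(\theta_j)/2$; $\tau$ is a fixed real number with $\tau>\sup_{\mathbf{x}\in\Omega_j}\|\nabla g_j(\mathbf{x})\|^2$. Let $\mathbb{N}^{n+1}_k:=\{(\alpha,i)\in\mathbb{N}^n\times\mathbb{N}:|\alpha|+i\le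 k\}$. For $\mathbf{u}=(u_{\alpha,k})_{(\alpha,k)\in\mathbb{N}^{n+1}_{2d}}$, define $L_{\mathbf{u}}(\sum p_{\alpha,k}\mathbf{x}^\alpha z^k)=\sum p_{\alpha,k}u_{\alpha,k}$. For $p\in\mathbb{R}[\mathbf{x},z]$, $\mathbf{M}_k(p\,\mathbf{u})$ is the real symmetric matrix indexed by $\mathbb{N}^{n+1}_k$ whose entry at $((\alpha,i),(\beta,i'))$ is $L_{\mathbf{u}}(p\,\mathbf{x}^{\alpha+\beta}z^{i+i'})$, and $\mathbf{M}_k(\mathbf{u}):=\mathbf{M}_k(1\,\mathbf{u})$. $\succeq0$ means positive semidefinite. The programs. $(\overline{\mathrm{Q}}_d)$ (resp. $(\underline{\mathrm{Q}}_d)$) is the problem of maximizing (resp. minimizing) $u_{0,1}$ over $\mathbf{u}=(u_{\alpha,k})_{(\alpha,k)\in\mathbb{N}^{n+1}_{2d}}$ subject to - $u_{\alpha,0}=v_{j,\alpha}$ for all $|\alpha|\le2d$; - $\mathbf{M}_d(\mathbf{u})\succeq0$ and $\mathbf{M}_{d-\ell_j}(\theta_j\,\mathbf{u})=0$; - $\mathbf{M}_{d-1}((\tau-z^2)\,\mathbf{u})\succeq0$ and $\mathbf{M}_{d-1}(z\,\mathbf{u})\succeq0$. The notation $\downarrow$ (resp. $\uparrow$) denotes monotone non-increasing (resp. non-decreasing) convergence. *)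

theory Defs
  imports "HOL-Analysis.Analysis" "HOL-Library.Poly_Mapping"
begin

section \<open>Hausdorff measure\<close>

text \<open>The empty set is treated separately because \<open>0 ^ 0 = 1\<close>: for \<open>s = 0\<close> a nonempty set
  contributes 1, so that the 0-dimensional measure counts points. With the factor
  \<^const>\<open>unit_ball_vol\<close>, the measure of dimension \<open>s\<close> is the usual surface area.\<close>

definition hausdorff_gauge :: "nat \<Rightarrow> 'a::metric_space set \<Rightarrow> ennreal" where
  "hausdorff_gauge s C =
     (if C = {} then 0 else ennreal (unit_ball_vol (real s) * (diameter C / 2) ^ s))"

text \<open>Boundedness is required explicitly: \<^const>\<open>diameter\<close> is real-valued and unspecified on
  unbounded sets.\<close>

definition hausdorff_content :: "nat \<Rightarrow> real \<Rightarrow> 'a::metric_space set \<Rightarrow> ennreal" where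
  "hausdorff_content s \<delta> A =
     (INF C \<in> {C :: nat \<Rightarrow> 'a set. A \<subseteq> (\<Union>i. C i) \<and> (\<forall>i. bounded (C i) \<and> diameter (C i) \<le> \<delta>)}.
        suminf (\<lambda>i. hausdorff_gauge s (C i)))"

definition hausdorff_outer :: "nat \<Rightarrow> 'a::metric_space set \<Rightarrow> ennreal" where
  "hausdorff_outer s A = (SUP \<delta> \<in> {0<..}. hausdorff_content s \<delta> A)"

definition hausdorff_measure :: "nat \<Rightarrow> 'a::metric_space measure" where
  "hausdorff_measure s = measure_of UNIV (sets borel) (hausdorff_outer s)"

text \<open>\<^const>\<open>measure_of\<close> would silently give the zero measure if \<^const>\<open>hausdorff_outer\<close> were not
  countably additive on the Borel sets. The following lemmas, leading to
  \<open>emeasure_hausdorff_measure\<close>, rule this out.\<close>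

lemma hausdorff_gauge_mono:
  "C \<subseteq> D \<Longrightarrow> bounded D \<Longrightarrow> hausdorff_gauge s C \<le> hausdorff_gauge s D"
  unfolding hausdorff_gauge_def
  by (auto intro!: ennreal_leI mult_left_mono power_mono divide_right_mono
        diameter_subset simp: diameter_ge_0 bounded_subset)

lemma hausdorff_content_mono: "A \<subseteq> B \<Longrightarrow> hausdorff_content s \<delta> A \<le> hausdorff_content s \<delta> B"
  unfolding hausdorff_content_def by (intro INF_superset_mono) auto

lemma hausdorff_content_antimono:
  "\<delta> \<le> \<epsilon> \<Longrightarrow> hausdorff_content s \<epsilon> A \<le> hausdorff_content s \<delta> A"
  unfolding hausdorff_content_def by (intro INF_superset_mono) (auto intro: order_trans)

lemma hausdorff_content_le_outer: "\<delta> > 0 \<Longrightarrow> hausdorff_content s \<delta> A \<le> hausdorff_outer s A"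
  unfolding hausdorff_outer_def by (intro SUP_upper) auto

lemma hausdorff_outer_mono: "A \<subseteq> B \<Longrightarrow> hausdorff_outer s A \<le> hausdorff_outer s B"
  unfolding hausdorff_outer_def by (intro SUP_mono) (auto intro: hausdorff_content_mono)

lemma hausdorff_outer_empty [simp]: "hausdorff_outer s ({} :: 'a::metric_space set) = 0"
proof -
  have "hausdorff_content s \<delta> ({} :: 'a set) = 0" if "\<delta> > 0" for \<delta> :: real
  proof -
    have "hausdorff_content s \<delta> ({} :: 'a set) \<le>
        suminf (\<lambda>i::nat. hausdorff_gauge s ({} :: 'a set))"
      unfolding hausdorff_content_def using that by (intro INF_lower2[where i="\<lambda>_. {}"]) auto
    then show ?thesis by (simp add: hausdorff_gauge_def)
  qed
  then show ?thesis unfolding hausdorff_outer_def by (auto intro!: antisym SUP_least)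
qed

lemma hausdorff_content_UN_le:
  "hausdorff_content s \<delta> (\<Union>i. A i) \<le> suminf (\<lambda>i. hausdorff_content s \<delta> (A i))"
proof (rule ennreal_le_epsilon)
  fix e :: real
  assume fin: "suminf (\<lambda>i. hausdorff_content s \<delta> (A i)) < top" and e: "0 < e"
  have "\<exists>C. A n \<subseteq> (\<Union>i. C i) \<and> (\<forall>i. bounded (C i) \<and> diameter (C i) \<le> \<delta>) \<and>
          suminf (\<lambda>i. hausdorff_gauge s (C i)) \<le> hausdorff_content s \<delta> (A n) + e * (1/2) ^ Suc n" for n
  proof -
    have "hausdorff_content s \<delta> (A n) < top"
      using ennreal_suminf_lessD[OF fin] by simp
    then have "hausdorff_content s \<delta> (A n) < hausdorff_content s \<delta> (A n) + ennreal (e * (1/2) ^ Suc n)"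
      using e by (auto simp: less_top[symmetric])
    then show ?thesis
      unfolding hausdorff_content_def INF_less_iff
      by (auto intro: less_imp_le simp: hausdorff_content_def)
  qed
  then obtain C where
    C: "\<And>n. A n \<subseteq> (\<Union>i. C n i)" "\<And>n i. bounded (C n i)" "\<And>n i. diameter (C n i) \<le> \<delta>"
    and le: "\<And>n. suminf (\<lambda>i. hausdorff_gauge s (C n i)) \<le> hausdorff_content s \<delta> (A n) + e * (1/2) ^ Suc n"
    by metis
  let ?D = "\<lambda>k. case_prod C (prod_decode k)"
  have cov: "(\<Union>n. A n) \<subseteq> (\<Union>k. ?D k)"
  proof
    fix x assume "x \<in> (\<Union>n. A n)"
    then obtain n i where "x \<in> C n i" using C(1) by blast
    then have "x \<in> ?D (prod_encode (n, i))" by simp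
    then show "x \<in> (\<Union>k. ?D k)" by (rule UN_I[OF UNIV_I])
  qed
  have "hausdorff_content s \<delta> (\<Union>i. A i) \<le> suminf (\<lambda>k. hausdorff_gauge s (?D k))"
    unfolding hausdorff_content_def
  proof (rule INF_lower2[where i="?D"])
    have "bounded (?D k) \<and> diameter (?D k) \<le> \<delta>" for k
      by (cases "prod_decode k") (simp add: C)
    with cov show "?D \<in> {C. (\<Union>i. A i) \<subseteq> (\<Union>i. C i) \<and> (\<forall>i. bounded (C i) \<and> diameter (C i) \<le> \<delta>)}"
      by (intro CollectI conjI allI) (assumption | blast)+
  qed simp
  also have "\<dots> = suminf (\<lambda>n. suminf (\<lambda>i. hausdorff_gauge s (C n i)))"
    using suminf_ennreal_2dimen[of "\<lambda>n. suminf (\<lambda>i. hausdorff_gauge s (C n i))"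
        "\<lambda>p. hausdorff_gauge s (case_prod C p)"] by simp
  also have "\<dots> \<le> suminf (\<lambda>n. hausdorff_content s \<delta> (A n) + e * (1/2) ^ Suc n)"
    using le by (intro suminf_le) auto
  also have "\<dots> = suminf (\<lambda>n. hausdorff_content s \<delta> (A n)) +
      suminf (\<lambda>n. ennreal (e * (1/2) ^ Suc n))"
    by (intro suminf_add[symmetric]) auto
  also have "suminf (\<lambda>n. ennreal (e * (1/2) ^ Suc n)) = e"
    using sums_mult[OF power_half_series, of e] e by (intro suminf_ennreal_eq) auto
  finally show "hausdorff_content s \<delta> (\<Union>i. A i) \<le> suminf (\<lambda>i. hausdorff_content s \<delta> (A i)) + ennreal e" .
qed

lemma hausdorff_outer_UN_le: "hausdorff_outer s (\<Union>i. A i) \<le> suminf (\<lambda>i. hausdorff_outer s (A i))"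
  unfolding hausdorff_outer_def[of s "\<Union>i. A i"]
  by (intro SUP_least order_trans[OF hausdorff_content_UN_le] suminf_le)
     (auto intro: hausdorff_content_le_outer)

lemma hausdorff_outer_Un_le:
  "hausdorff_outer s (A \<union> B) \<le> hausdorff_outer s A + hausdorff_outer s B"
proof -
  have "hausdorff_outer s (\<Union>i. binaryset A B i) \<le> suminf (\<lambda>i. hausdorff_outer s (binaryset A B i))"
    by (rule hausdorff_outer_UN_le)
  then show ?thesis by (simp add: UN_binaryset_eq suminf_binaryset_eq)
qed

lemma outer_measure_space_hausdorff_outer: "outer_measure_space UNIV (hausdorff_outer s)"
  unfolding outer_measure_space_def positive_def increasing_def countably_subadditive_def
  by (simp add: hausdorff_outer_mono hausdorff_outer_UN_le)

lemma hausdorff_content_separated: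
  assumes sep: "\<And>x y. x \<in> A \<Longrightarrow> y \<in> B \<Longrightarrow> r \<le> dist x y" and "\<delta> < r"
  shows "hausdorff_content s \<delta> A + hausdorff_content s \<delta> B \<le> hausdorff_content s \<delta> (A \<union> B)"
  unfolding hausdorff_content_def[of s \<delta> "A \<union> B"]
proof (intro INF_greatest, clarify)
  fix C :: "nat \<Rightarrow> 'a set"
  assume cov: "A \<union> B \<subseteq> \<Union> (range C)" and C: "\<forall>i. bounded (C i) \<and> diameter (C i) \<le> \<delta>"
  have part: "hausdorff_content s \<delta> X \<le> suminf (\<lambda>i. hausdorff_gauge s (C i \<inter> X))" if "X \<subseteq> A \<union> B" for X
  proof -
    have "diameter (C i \<inter> X) \<le> \<delta>" "bounded (C i \<inter> X)" for i
      using C diameter_subset[of "C i \<inter> X" "C i"] by (auto intro: order_trans bounded_subset)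
    then show ?thesis
      unfolding hausdorff_content_def using that cov by (intro INF_lower) auto
  qed
  have "hausdorff_content s \<delta> A + hausdorff_content s \<delta> B \<le>
      suminf (\<lambda>i. hausdorff_gauge s (C i \<inter> A)) + suminf (\<lambda>i. hausdorff_gauge s (C i \<inter> B))"
    by (intro add_mono part) auto
  also have "\<dots> = suminf (\<lambda>i. hausdorff_gauge s (C i \<inter> A) + hausdorff_gauge s (C i \<inter> B))"
    by (intro suminf_add) auto
  also have "\<dots> \<le> suminf (\<lambda>i. hausdorff_gauge s (C i))"
  proof (intro suminf_le)
    fix i
    have "C i \<inter> A = {} \<or> C i \<inter> B = {}"
    proof (rule ccontr)
      assume "\<not> ?thesis"
      then obtain x y where xy: "x \<in> C i" "x \<in> A" "y \<in> C i" "y \<in> B" by auto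
      then have "dist x y \<le> diameter (C i)" using C by (intro diameter_bounded_bound) auto
      also have "\<dots> \<le> \<delta>" using C by simp
      finally have "dist x y \<le> \<delta>" .
      with sep[of x y] xy \<open>\<delta> < r\<close> show False by auto
    qed
    then show "hausdorff_gauge s (C i \<inter> A) + hausdorff_gauge s (C i \<inter> B) \<le> hausdorff_gauge s (C i)"
      using hausdorff_gauge_mono[of "C i \<inter> A" "C i" s] hausdorff_gauge_mono[of "C i \<inter> B" "C i" s] C
      by (auto simp: hausdorff_gauge_def[of s "{}"])
  qed auto
  finally show "hausdorff_content s \<delta> A + hausdorff_content s \<delta> B \<le> suminf (\<lambda>i. hausdorff_gauge s (C i))" .
qed

lemma hausdorff_outer_separated:
  assumes sep: "\<And>x y. x \<in> A \<Longrightarrow> y \<in> B \<Longrightarrow> r \<le> dist x y" and "r > 0"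
  shows "hausdorff_outer s A + hausdorff_outer s B = hausdorff_outer s (A \<union> B)"
proof (rule antisym)
  have "hausdorff_content s \<delta> A + hausdorff_content s \<epsilon> B \<le> hausdorff_outer s (A \<union> B)"
    if "\<delta> > 0" "\<epsilon> > 0" for \<delta> \<epsilon>
  proof -
    let ?d = "min (min \<delta> \<epsilon>) (r / 2)"
    have "hausdorff_content s \<delta> A + hausdorff_content s \<epsilon> B \<le>
        hausdorff_content s ?d A + hausdorff_content s ?d B"
      by (intro add_mono hausdorff_content_antimono) auto
    also have "\<dots> \<le> hausdorff_content s ?d (A \<union> B)"
      using \<open>r > 0\<close> by (intro hausdorff_content_separated[OF sep]) auto
    also have "\<dots> \<le> hausdorff_outer s (A \<union> B)"
      using that \<open>r > 0\<close> by (intro hausdorff_content_le_outer) auto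
    finally show ?thesis .
  qed
  then have "hausdorff_content s \<delta> A + hausdorff_outer s B \<le> hausdorff_outer s (A \<union> B)"
    if "\<delta> > 0" for \<delta>
    unfolding hausdorff_outer_def[of s B] using that
    by (subst ennreal_SUP_add_right) (auto intro!: SUP_least)
  then show "hausdorff_outer s A + hausdorff_outer s B \<le> hausdorff_outer s (A \<union> B)"
    unfolding hausdorff_outer_def[of s A]
    by (subst ennreal_SUP_add_left[symmetric]) (auto intro!: SUP_least)
qed (rule hausdorff_outer_Un_le)

lemma hausdorff_outer_closed:
  fixes F :: "'a::metric_space set"
  assumes F: "closed F"
  shows "F \<in> lambda_system UNIV UNIV (hausdorff_outer s)"
proof -
  let ?H = "hausdorff_outer s :: 'a set \<Rightarrow> ennreal"
  have main: "?H (E \<inter> F) + ?H (E - F) \<le> ?H E" if nonempty: "F \<noteq> {}" and fin: "?H E < top" for E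
  proof -
    define A where "A k = {x \<in> E - F. 1 / real (Suc k) < infdist x F}" for k
    define R where "R k = A (Suc k) - A k" for k
    have sepF: "?H (E \<inter> F) + ?H (A k) \<le> ?H E" for k
    proof -
      have "?H (E \<inter> F) + ?H (A k) = ?H (E \<inter> F \<union> A k)"
      proof (rule hausdorff_outer_separated)
        show "1 / real (Suc k) \<le> dist x y" if "x \<in> E \<inter> F" "y \<in> A k" for x y
          using that infdist_le[of x F y] by (auto simp: A_def dist_commute)
      qed auto
      also have "\<dots> \<le> ?H E" by (rule hausdorff_outer_mono) (auto simp: A_def)
      finally show ?thesis .
    qed
    have sepR: "1 / real (k + 2) - 1 / real (k + 3) \<le> dist x y"
      if "x \<in> A (Suc k)" "y \<in> R j" "k + 2 \<le> j" for x y k j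
    proof -
      have x: "1 / real (k + 2) < infdist x F" using that by (auto simp: A_def)
      have "infdist y F \<le> 1 / real (Suc j)" using that by (auto simp: A_def R_def)
      also have "\<dots> \<le> 1 / real (k + 3)" using that by (intro divide_left_mono) auto
      finally show ?thesis using x infdist_triangle[of x F y] by linarith
    qed
    have sumR: "(\<Sum>k<n. ?H (R (2 * k + p))) = ?H (\<Union>k<n. R (2 * k + p))" for n p
    proof (induction n)
      case (Suc n)
      have "?H (\<Union>k<n. R (2 * k + p)) + ?H (R (2 * n + p)) =
          ?H ((\<Union>k<n. R (2 * k + p)) \<union> R (2 * n + p))"
      proof (cases "n = 0")
        case False
        let ?k = "2 * n + p - 2"
        show ?thesis
        proof (rule hausdorff_outer_separated)
          fix x y assume x: "x \<in> (\<Union>k<n. R (2 * k + p))" and y: "y \<in> R (2 * n + p)"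
          have mono: "A i \<subseteq> A i'" if "i \<le> i'" for i i'
          proof -
            have "1 / real (Suc i') \<le> 1 / real (Suc i)" using that by (intro divide_left_mono) auto
            then show ?thesis by (auto simp: A_def)
          qed
          from x obtain k where "k < n" "x \<in> A (Suc (2 * k + p))" by (auto simp: R_def)
          moreover from \<open>k < n\<close> have "Suc (2 * k + p) \<le> Suc ?k" by linarith
          ultimately have "x \<in> A (Suc ?k)" using mono by blast
          then show "1 / real (?k + 2) - 1 / real (?k + 3) \<le> dist x y"
            using y False by (intro sepR) auto
        next
          have "1 / real (?k + 3) < 1 / real (?k + 2)" by (intro divide_strict_left_mono) auto
          then show "0 < 1 / real (?k + 2) - 1 / real (?k + 3)" by simp
        qed
      qed simp
      then show ?case using Suc by (simp add: lessThan_Suc Un_commute add.commute)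
    qed simp
    have sumR_le: "suminf (\<lambda>k. ?H (R (2 * k + p))) \<le> ?H E" for p
    proof (rule suminf_le_const)
      show "(\<Sum>k<n. ?H (R (2 * k + p))) \<le> ?H E" for n
        unfolding sumR by (rule hausdorff_outer_mono) (auto simp: R_def A_def)
    qed auto
    have "(\<Sum>k<n. ?H (R k)) \<le> ?H E + ?H E" for n
    proof -
      have "(\<Sum>k<n. ?H (R k)) \<le> (\<Sum>k<2 * n. ?H (R k))" by (intro sum_mono2) auto
      also have "\<dots> = (\<Sum>k<n. ?H (R (2 * k + 0))) + (\<Sum>k<n. ?H (R (2 * k + 1)))"
        by (induction n) (auto simp: algebra_simps)
      also have "\<dots> \<le> suminf (\<lambda>k. ?H (R (2 * k + 0))) + suminf (\<lambda>k. ?H (R (2 * k + 1)))"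
        by (intro add_mono sum_le_suminf) auto
      also have "\<dots> \<le> ?H E + ?H E" by (intro add_mono sumR_le)
      finally show ?thesis .
    qed
    then have "suminf (\<lambda>k. ?H (R k)) \<le> ?H E + ?H E" by (intro suminf_le_const) auto
    then have finR: "suminf (\<lambda>k. ?H (R k)) \<noteq> \<infinity>" using fin by (auto simp: top_unique)
    have tail: "(\<lambda>n. suminf (\<lambda>k. ?H (R (k + n)))) \<longlonglongrightarrow> 0"
    proof -
      have top: "?H (R k) < top" for k
        using finR ennreal_suminf_lessD[of "\<lambda>k. ?H (R k)" top k] by (simp add: less_top)
      define f where "f k = enn2real (?H (R k))" for k
      have f: "?H (R k) = ennreal (f k)" "0 \<le> f k" for k using top[of k] by (auto simp: f_def)
      have sm: "summable f" using finR f by (auto intro: summable_suminf_not_top)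
      have "(\<lambda>n. ennreal (suminf (\<lambda>k. f (k + n)))) \<longlonglongrightarrow> ennreal 0"
        using suminf_exist_split2[OF sm] by (intro tendsto_ennrealI)
      moreover have "suminf (\<lambda>k. ?H (R (k + n))) = ennreal (suminf (\<lambda>k. f (k + n)))" for n
        unfolding f(1) using sm f(2) by (intro suminf_ennreal2) auto
      ultimately show ?thesis by simp
    qed
    have EF: "?H (E - F) \<le> ?H (A n) + suminf (\<lambda>k. ?H (R (k + n)))" for n
    proof -
      have "E - F \<subseteq> A n \<union> (\<Union>k. R (k + n))"
      proof
        fix x assume x: "x \<in> E - F"
        then have "0 < infdist x F" using F nonempty
          by (metis DiffD2 in_closed_iff_infdist_zero infdist_nonneg less_eq_real_def)
        then obtain m where m: "1 / real (Suc m) < infdist x F"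
          by (metis nat_approx_posE)
        show "x \<in> A n \<union> (\<Union>k. R (k + n))"
        proof (cases "x \<in> A n")
          case False
          define j where "j = (LEAST j. x \<in> A j)"
          have ex: "x \<in> A m" using m x by (auto simp: A_def)
          then have j: "x \<in> A j" unfolding j_def by (rule LeastI)
          have "j > n"
          proof (rule ccontr)
            assume "\<not> n < j"
            then have "1 / real (Suc n) \<le> 1 / real (Suc j)" by (intro divide_left_mono) auto
            with j False show False by (auto simp: A_def)
          qed
          moreover from this have "x \<notin> A (j - 1)" unfolding j_def
            by (intro not_less_Least) (auto simp: j_def)
          ultimately have "x \<in> R ((j - 1 - n) + n)" using j by (auto simp: R_def)
          then show ?thesis by blast
        qed simp
      qed
      then have "?H (E - F) \<le> ?H (A n \<union> (\<Union>k. R (k + n)))" by (rule hausdorff_outer_mono)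
      also have "\<dots> \<le> ?H (A n) + ?H (\<Union>k. R (k + n))" by (rule hausdorff_outer_Un_le)
      also have "\<dots> \<le> ?H (A n) + suminf (\<lambda>k. ?H (R (k + n)))"
        by (intro add_left_mono hausdorff_outer_UN_le)
      finally show ?thesis .
    qed
    have "?H (E \<inter> F) + ?H (E - F) \<le> ?H E + suminf (\<lambda>k. ?H (R (k + n)))" for n
    proof -
      have "?H (E \<inter> F) + ?H (E - F) \<le> ?H (E \<inter> F) + (?H (A n) + suminf (\<lambda>k. ?H (R (k + n))))"
        by (intro add_left_mono EF)
      also have "\<dots> \<le> ?H E + suminf (\<lambda>k. ?H (R (k + n)))"
        unfolding add.assoc[symmetric] by (intro add_right_mono sepF)
      finally show ?thesis .
    qed
    moreover have "(\<lambda>n. ?H E + suminf (\<lambda>k. ?H (R (k + n)))) \<longlonglongrightarrow> ?H E + 0"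
      by (intro tendsto_add tendsto_const tail)
    ultimately show ?thesis by (intro LIMSEQ_le_const[where X="\<lambda>n. ?H E + suminf (\<lambda>k. ?H (R (k + n)))"]) auto
  qed
  have "?H (F \<inter> E) + ?H (- F \<inter> E) = ?H E" for E
  proof (rule antisym)
    show "?H (F \<inter> E) + ?H (- F \<inter> E) \<le> ?H E"
    proof (cases "F = {} \<or> ?H E = top")
      case False
      then show ?thesis using main[of E] by (simp add: Int_commute Diff_eq less_top)
    qed auto
    have "E = F \<inter> E \<union> - F \<inter> E" by auto
    then show "?H E \<le> ?H (F \<inter> E) + ?H (- F \<inter> E)" by (metis hausdorff_outer_Un_le)
  qed
  then show ?thesis by (simp add: lambda_system_def Compl_eq_Diff_UNIV)
qed

lemma sets_hausdorff_measure [simp, measurable_cong]: "sets (hausdorff_measure s) = sets borel"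
  unfolding hausdorff_measure_def using sets.sigma_sets_eq[of borel] by simp

lemma space_hausdorff_measure [simp]: "space (hausdorff_measure s) = UNIV"
  unfolding hausdorff_measure_def by simp

theorem emeasure_hausdorff_measure:
  fixes A :: "'a::metric_space set"
  assumes "A \<in> sets borel"
  shows "emeasure (hausdorff_measure s) A = hausdorff_outer s A"
proof -
  let ?L = "lambda_system UNIV UNIV (hausdorff_outer s :: 'a set \<Rightarrow> ennreal)"
  interpret P: sigma_algebra "UNIV :: 'a set" UNIV using sigma_algebra_Pow[of UNIV] by simp
  have L: "measure_space UNIV ?L (hausdorff_outer s)"
    by (rule P.caratheodory_lemma[OF outer_measure_space_hausdorff_outer])
  then interpret L: sigma_algebra UNIV ?L by (simp add: measure_space_def)
  have "sigma_sets UNIV (Collect closed) \<subseteq> ?L"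
    by (intro L.sigma_sets_subset) (auto intro: hausdorff_outer_closed)
  then have sub: "sets (borel :: 'a measure) \<subseteq> ?L"
    by (simp add: borel_eq_closed)
  show ?thesis unfolding hausdorff_measure_def
  proof (rule emeasure_measure_of_sigma)
    show "sigma_algebra UNIV (sets (borel :: 'a measure))"
      using sets.sigma_algebra_axioms[of borel] by simp
    show "positive (sets (borel :: 'a measure)) (hausdorff_outer s)"
      by (simp add: positive_def)
    show "countably_additive (sets (borel :: 'a measure)) (hausdorff_outer s)"
      unfolding countably_additive_def
    proof (intro allI impI)
      fix A :: "nat \<Rightarrow> 'a set"
      assume A: "range A \<subseteq> sets borel" "disjoint_family A" "\<Union> (range A) \<in> sets borel"
      have "countably_additive ?L (hausdorff_outer s)" using L by (simp add: measure_space_def)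
      moreover have "range A \<subseteq> ?L" "\<Union> (range A) \<in> ?L" using A(1,3) sub by (auto simp only: subset_iff)
      ultimately show "suminf (\<lambda>i. hausdorff_outer s (A i)) = hausdorff_outer s (\<Union> (range A))"
        using A(2) by (simp add: countably_additive_def)
    qed
  qed (use assms in auto)
qed


section \<open>Polynomials\<close>

text \<open>\<open>\<real>[x]\<close> and \<open>\<real>[x, z]\<close> as finitely supported functions on the exponents
  \<open>\<alpha> \<in> \<nat>\<^sup>n\<close>, respectively \<open>(\<alpha>, k) \<in> \<nat>\<^sup>n \<times> \<nat>\<close>, with convolution as product;
  the monomial \<open>c \<cdot> x\<^sup>\<alpha>\<close> is \<open>Poly_Mapping.single \<alpha> c\<close>.\<close>

type_synonym 'n exps = "nat ^ 'n"
type_synonym 'n xpoly = "'n exps \<Rightarrow>\<^sub>0 real"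
type_synonym 'n xzpoly = "'n exps \<times> nat \<Rightarrow>\<^sub>0 real"

definition exps_abs :: "'n::finite exps \<Rightarrow> nat" where
  "exps_abs \<alpha> = (\<Sum>i\<in>UNIV. \<alpha> $ i)"

definition x_monom :: "'n::finite exps \<Rightarrow> real ^ 'n \<Rightarrow> real" where
  "x_monom \<alpha> x = (\<Prod>i\<in>UNIV. (x $ i) ^ (\<alpha> $ i))"

definition x_eval :: "'n::finite xpoly \<Rightarrow> real ^ 'n \<Rightarrow> real" where
  "x_eval p x = (\<Sum>\<alpha>\<in>Poly_Mapping.keys p. Poly_Mapping.lookup p \<alpha> * x_monom \<alpha> x)"

definition x_homogeneous :: "nat \<Rightarrow> 'n::finite xpoly \<Rightarrow> bool" where
  "x_homogeneous d p \<longleftrightarrow> (\<forall>\<alpha>\<in>Poly_Mapping.keys p. exps_abs \<alpha> = d)"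

definition x_partial :: "'n::finite \<Rightarrow> 'n xpoly \<Rightarrow> 'n xpoly" where
  "x_partial i p = (\<Sum>\<alpha>\<in>Poly_Mapping.keys p. Poly_Mapping.single (\<alpha> - axis i 1) (real (\<alpha> $ i) * Poly_Mapping.lookup p \<alpha>))"

definition x_grad :: "'n::finite xpoly \<Rightarrow> real ^ 'n \<Rightarrow> real ^ 'n" where
  "x_grad p x = (\<chi> i. x_eval (x_partial i p) x)"

definition xz_of_x :: "'n::finite xpoly \<Rightarrow> 'n xzpoly" where
  "xz_of_x p = (\<Sum>\<alpha>\<in>Poly_Mapping.keys p. Poly_Mapping.single (\<alpha>, 0) (Poly_Mapping.lookup p \<alpha>))"

definition xz_const :: "real \<Rightarrow> 'n::finite xzpoly" where
  "xz_const c = Poly_Mapping.single (0, 0) c"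

definition xz_z :: "'n::finite xzpoly" where
  "xz_z = Poly_Mapping.single (0, 1) 1"

definition xz_degree :: "'n::finite xzpoly \<Rightarrow> nat" where
  "xz_degree p = Max (insert 0 ((\<lambda>(\<alpha>, k). exps_abs \<alpha> + k) ` Poly_Mapping.keys p))"


section \<open>Moment and localizing matrices\<close>

definition xz_exps :: "nat \<Rightarrow> ('n::finite exps \<times> nat) set" where
  "xz_exps k = {(\<alpha>, i). exps_abs \<alpha> + i \<le> k}"

lemma finite_xz_exps: "finite (xz_exps k :: ('n::finite exps \<times> nat) set)"
proof (rule finite_subset)
  let ?V = "vec_lambda ` (PiE UNIV (\<lambda>_. {..k})) :: 'n exps set"
  show "xz_exps k \<subseteq> ?V \<times> {..k}"
  proof
    fix a :: "'n exps \<times> nat" assume "a \<in> xz_exps k"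
    then obtain \<alpha> i where a: "a = (\<alpha>, i)" and le: "exps_abs \<alpha> + i \<le> k"
      by (auto simp: xz_exps_def)
    have "\<alpha> $ j \<le> exps_abs \<alpha>" for j
      unfolding exps_abs_def by (intro member_le_sum) auto
    with le have "\<alpha> $ j \<le> k" for j by (meson add_leD1 order_trans)
    then have "vec_nth \<alpha> \<in> PiE UNIV (\<lambda>_. {..k})" by auto
    then have "vec_lambda (vec_nth \<alpha>) \<in> ?V" by (rule imageI)
    with a le show "a \<in> ?V \<times> {..k}" by simp
  qed
  show "finite (?V \<times> {..k})" by (intro finite_cartesian_product finite_imageI finite_PiE) auto
qed

definition riesz :: "('n::finite exps \<times> nat \<Rightarrow> real) \<Rightarrow> 'n xzpoly \<Rightarrow> real" where
  "riesz u p = (\<Sum>a\<in>Poly_Mapping.keys p. Poly_Mapping.lookup p a * u a)"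

text \<open>The matrix \<open>M\<^sub>k(p u)\<close> is the restriction of \<open>local_matrix p u\<close> to the finite index set
  \<open>xz_exps k\<close>.\<close>

definition local_matrix ::
  "'n::finite xzpoly \<Rightarrow> ('n exps \<times> nat \<Rightarrow> real) \<Rightarrow> 'n exps \<times> nat \<Rightarrow> 'n exps \<times> nat \<Rightarrow> real" where
  "local_matrix p u a b = riesz u (p * Poly_Mapping.single (a + b) 1)"

definition psd_on :: "'i set \<Rightarrow> ('i \<Rightarrow> 'i \<Rightarrow> real) \<Rightarrow> bool" where
  "psd_on I M \<longleftrightarrow> (\<forall>a\<in>I. \<forall>b\<in>I. M a b = M b a) \<and>
     (\<forall>c :: 'i \<Rightarrow> real. 0 \<le> (\<Sum>a\<in>I. \<Sum>b\<in>I. c a * M a b * c b))"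

definition zero_on :: "'i set \<Rightarrow> ('i \<Rightarrow> 'i \<Rightarrow> real) \<Rightarrow> bool" where
  "zero_on I M \<longleftrightarrow> (\<forall>a\<in>I. \<forall>b\<in>I. M a b = 0)"


section \<open>The set, its boundary measures, and the programs\<close>

definition Omega :: "nat \<Rightarrow> (nat \<Rightarrow> 'n::finite xpoly) \<Rightarrow> (nat \<Rightarrow> real) \<Rightarrow> (real ^ 'n) set" where
  "Omega m g b = {x. \<forall>j\<in>{1..m}. x_eval (g j) x \<le> b j}"

definition Omega_face ::
  "nat \<Rightarrow> (nat \<Rightarrow> 'n::finite xpoly) \<Rightarrow> (nat \<Rightarrow> real) \<Rightarrow> nat \<Rightarrow> (real ^ 'n) set" where
  "Omega_face m g b j = {x \<in> Omega m g b. x_eval (g j) x = b j}"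

text \<open>The measures live on the whole Borel \<open>\<sigma>\<close>-algebra and are concentrated on the boundary
  and its faces by means of indicator densities. With \<^const>\<open>restrict_space\<close> instead,
  \<open>\<sigma>\<^sub>j {x. g\<^sub>k x = b\<^sub>k}\<close> would be 0 whenever the set is not contained in \<open>\<Omega>\<^sub>j\<close>.\<close>

definition sigma_bd ::
  "nat \<Rightarrow> (nat \<Rightarrow> 'n::finite xpoly) \<Rightarrow> (nat \<Rightarrow> real) \<Rightarrow> (real ^ 'n) measure" where
  "sigma_bd m g b = density (hausdorff_measure (CARD('n) - 1)) (indicator (frontier (Omega m g b)))"

definition sigma_face ::
  "nat \<Rightarrow> (nat \<Rightarrow> 'n::finite xpoly) \<Rightarrow> (nat \<Rightarrow> real) \<Rightarrow> nat \<Rightarrow> (real ^ 'n) measure" where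
  "sigma_face m g b j = density (sigma_bd m g b) (indicator (Omega_face m g b j))"

definition phi_face ::
  "nat \<Rightarrow> (nat \<Rightarrow> 'n::finite xpoly) \<Rightarrow> (nat \<Rightarrow> real) \<Rightarrow> nat \<Rightarrow> (real ^ 'n) measure" where
  "phi_face m g b j = density (sigma_face m g b j) (\<lambda>x. ennreal (1 / norm (x_grad (g j) x)))"

definition phi_moment ::
  "nat \<Rightarrow> (nat \<Rightarrow> 'n::finite xpoly) \<Rightarrow> (nat \<Rightarrow> real) \<Rightarrow> nat \<Rightarrow> 'n exps \<Rightarrow> real" where
  "phi_moment m g b j \<alpha> = (LINT x:Omega_face m g b j|phi_face m g b j. x_monom \<alpha> x)"

definition theta :: "'n::finite xpoly \<Rightarrow> 'n xzpoly" where
  "theta p = xz_z ^ 2 - xz_of_x (\<Sum>i\<in>UNIV. (x_partial i p) ^ 2)"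

text \<open>The degree of \<open>\<theta>\<close> is even, being the maximum of 2 and the degree of a sum of squares, so
  the division is exact.\<close>

definition theta_half_degree :: "'n::finite xpoly \<Rightarrow> nat" where
  "theta_half_degree p = xz_degree (theta p) div 2"

definition d2_min :: "nat \<Rightarrow> (nat \<Rightarrow> 'n::finite xpoly) \<Rightarrow> (nat \<Rightarrow> nat) \<Rightarrow> nat \<Rightarrow> nat" where
  "d2_min m g dg j = Max ({1, theta_half_degree (g j)} \<union> (\<lambda>k. nat \<lceil>real (dg k) / 2\<rceil>) ` {1..m})"

text \<open>The common feasible set of the maximization and the minimization program of order \<open>d\<close>.
  For \<open>d \<ge> d2_min m g dg j\<close> only the entries of \<open>u\<close> indexed by \<open>xz_exps (2 * d)\<close> occur
  in the constraints; values elsewhere are irrelevant.\<close>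

definition Q_feasible ::
  "nat \<Rightarrow> (nat \<Rightarrow> 'n::finite xpoly) \<Rightarrow> (nat \<Rightarrow> real) \<Rightarrow> nat \<Rightarrow> real \<Rightarrow> nat \<Rightarrow>
   ('n exps \<times> nat \<Rightarrow> real) set" where
  "Q_feasible m g b j \<tau> d = {u.
     (\<forall>\<alpha>. exps_abs \<alpha> \<le> 2 * d \<longrightarrow> u (\<alpha>, 0) = phi_moment m g b j \<alpha>) \<and>
     psd_on (xz_exps d) (local_matrix 1 u) \<and>
     zero_on (xz_exps (d - theta_half_degree (g j))) (local_matrix (theta (g j)) u) \<and>
     psd_on (xz_exps (d - 1)) (local_matrix (xz_const \<tau> - xz_z ^ 2) u) \<and>
     psd_on (xz_exps (d - 1)) (local_matrix xz_z u)}"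

definition Q_objective :: "('n::finite exps \<times> nat \<Rightarrow> real) \<Rightarrow> real" where
  "Q_objective u = u (0, 1)"

definition Q_max_optimal ::
  "nat \<Rightarrow> (nat \<Rightarrow> 'n::finite xpoly) \<Rightarrow> (nat \<Rightarrow> real) \<Rightarrow> nat \<Rightarrow> real \<Rightarrow> nat \<Rightarrow>
   ('n exps \<times> nat \<Rightarrow> real) \<Rightarrow> bool" where
  "Q_max_optimal m g b j \<tau> d = is_arg_max Q_objective (\<lambda>u. u \<in> Q_feasible m g b j \<tau> d)"

definition Q_min_optimal ::
  "nat \<Rightarrow> (nat \<Rightarrow> 'n::finite xpoly) \<Rightarrow> (nat \<Rightarrow> real) \<Rightarrow> nat \<Rightarrow> real \<Rightarrow> nat \<Rightarrow>
   ('n exps \<times> nat \<Rightarrow> real) \<Rightarrow> bool" where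
  "Q_min_optimal m g b j \<tau> d = is_arg_min Q_objective (\<lambda>u. u \<in> Q_feasible m g b j \<tau> d)"

definition Q_max_value ::
  "nat \<Rightarrow> (nat \<Rightarrow> 'n::finite xpoly) \<Rightarrow> (nat \<Rightarrow> real) \<Rightarrow> nat \<Rightarrow> real \<Rightarrow> nat \<Rightarrow> ereal" where
  "Q_max_value m g b j \<tau> d = (SUP u\<in>Q_feasible m g b j \<tau> d. ereal (Q_objective u))"

definition Q_min_value ::
  "nat \<Rightarrow> (nat \<Rightarrow> 'n::finite xpoly) \<Rightarrow> (nat \<Rightarrow> real) \<Rightarrow> nat \<Rightarrow> real \<Rightarrow> nat \<Rightarrow> ereal" where
  "Q_min_value m g b j \<tau> d = (INF u\<in>Q_feasible m g b j \<tau> d. ereal (Q_objective u))"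

end

theory Submission
  imports Defs
begin

text \<open>
  Let \<open>h = \<parallel>\<nabla>g\<^sub>j\<parallel>\<close>, so that \<open>\<integral> p d\<phi>\<^sub>j = \<integral> p / h d\<sigma>\<^sub>j\<close>, and let \<open>L\<close> be the Riesz functional of a point
  feasible at order \<open>d\<close>. In the range of degrees that \<open>d\<close> controls, \<open>L\<close> integrates polynomials in
  \<open>x\<close> against \<open>\<phi>\<^sub>j\<close>, treats \<open>z\<^sup>2\<close> as \<open>h\<^sup>2\<close>, and is nonnegative on squares and on \<open>z\<close> times
  squares. So \<open>z\<close> behaves like the nonnegative square root \<open>h\<close> of \<open>h\<^sup>2\<close>, and \<open>L(x\<^sup>\<alpha> z)\<close> should be
  near \<open>\<integral> x\<^sup>\<alpha> h d\<phi>\<^sub>j = \<integral> x\<^sup>\<alpha> d\<sigma>\<^sub>j\<close>.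

  The proof makes this quantitative without a representing measure. Choose a polynomial \<open>s\<close> in \<open>x\<close>
  such that \<open>s\<^sup>4\<close> is uniformly close to \<open>h\<^sup>2\<close> on the face. Then \<open>s\<^sup>2\<close> is close to \<open>h\<close>, and
  \<open>(z - s\<^sup>2)\<^sup>4 = (z\<^sup>2 - s\<^sup>4)\<^sup>2 - 4 z (s (z - s\<^sup>2))\<^sup>2\<close>.
  The subtracted term is \<open>z\<close> times a square, and \<open>z\<^sup>2 - s\<^sup>4\<close> differs from \<open>h\<^sup>2 - s\<^sup>4\<close> by \<open>\<theta>\<^sub>j\<close>, which
  \<open>L\<close> annihilates. So \<open>L((z - s\<^sup>2)\<^sup>4) \<le> \<integral> (h\<^sup>2 - s\<^sup>4)\<^sup>2 d\<phi>\<^sub>j\<close>, which is small, and two applications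
  of the Cauchy-Schwarz inequality bound \<open>L(x\<^sup>\<alpha> (z - s\<^sup>2))\<close> (\<open>riesz_root_estimate\<close>). Since
  \<open>L(x\<^sup>\<alpha> s\<^sup>2) = \<integral> x\<^sup>\<alpha> s\<^sup>2 d\<phi>\<^sub>j\<close> is close to \<open>\<integral> x\<^sup>\<alpha> d\<sigma>\<^sub>j\<close>, the entry \<open>u\<^sub>\<alpha>\<^sub>,\<^sub>1\<close> is close to the desired
  integral. The order \<open>d\<close> enters only by having to exceed the degrees of the finitely many
  polynomials involved, so the estimate is uniform over the whole feasible set
  (\<open>feasible_first_moments_converge\<close>), and it serves the maximization and the minimization alike.

  Two further ingredients are independent of this. First, the integrals make sense because
  \<open>\<sigma>\<^sub>j\<close> is finite: where some \<open>\<partial>\<^sub>i g\<^sub>j\<close> does not vanish, a level set is controlled by its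
  other \<open>n - 1\<close> coordinates, so a grid in these coordinates yields efficient covers, and
  the face is compact (\<open>hausdorff_outer_regular_level_set_finite\<close>). Second, optimal
  solutions exist because the constraint on \<open>\<tau> - z\<^sup>2\<close>, the fixed moments and positive
  semidefiniteness bound all entries of a feasible point that the constraints see, so that the
  objective takes all its values on a compact set (\<open>Q_feasible_compact_representatives\<close>).
\<close>


section \<open>Linear functionals on polynomials and evaluation\<close>

lemma poly_mapping_eq_sum_single:
  fixes p :: "'a \<Rightarrow>\<^sub>0 'b::comm_monoid_add"
  assumes "finite I" "Poly_Mapping.keys p \<subseteq> I"
  shows "p = (\<Sum>a\<in>I. Poly_Mapping.single a (Poly_Mapping.lookup p a))"
proof (rule poly_mapping_eqI)
  fix k
  have "(\<Sum>a\<in>I. Poly_Mapping.lookup (Poly_Mapping.single a (Poly_Mapping.lookup p a)) k) =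
      (\<Sum>a\<in>I. if a = k then Poly_Mapping.lookup p k else 0)"
    by (intro sum.cong) (auto simp: lookup_single)
  also have "\<dots> = Poly_Mapping.lookup p k"
    using assms by (auto simp: in_keys_iff subset_iff)
  finally show "Poly_Mapping.lookup p k =
      Poly_Mapping.lookup (\<Sum>a\<in>I. Poly_Mapping.single a (Poly_Mapping.lookup p a)) k"
    by (simp add: lookup_sum)
qed

lemma poly_mapping_additive_induct [case_names zero single add]:
  fixes p :: "'a \<Rightarrow>\<^sub>0 'b::comm_monoid_add"
  assumes "P 0" and "\<And>a c. P (Poly_Mapping.single a c)" and "\<And>p q. P p \<Longrightarrow> P q \<Longrightarrow> P (p + q)"
  shows "P p"
proof -
  have "P (\<Sum>a\<in>I. Poly_Mapping.single a (Poly_Mapping.lookup p a))" if "finite I" for I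
    using that by (induction I) (auto intro: assms)
  then show ?thesis
    using poly_mapping_eq_sum_single[of "Poly_Mapping.keys p" p] by (metis finite_keys order_refl)
qed

text \<open>Both polynomial evaluation and the Riesz functional are of this form, with the monomial values,
respectively the moments, as \<open>u\<close>; they share its calculus.\<close>

definition lin_ext :: "('a \<Rightarrow> 'b) \<Rightarrow> ('a \<Rightarrow>\<^sub>0 'b) \<Rightarrow> 'b::comm_ring_1" where
  "lin_ext u p = (\<Sum>a\<in>Poly_Mapping.keys p. Poly_Mapping.lookup p a * u a)"

lemma lin_ext_superset:
  "finite I \<Longrightarrow> Poly_Mapping.keys p \<subseteq> I \<Longrightarrow> lin_ext u p = (\<Sum>a\<in>I. Poly_Mapping.lookup p a * u a)"
  unfolding lin_ext_def by (intro sum.mono_neutral_left) (auto simp: in_keys_iff)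

lemma lin_ext_zero [simp]: "lin_ext u 0 = 0"
  by (simp add: lin_ext_def)

lemma lin_ext_single [simp]: "lin_ext u (Poly_Mapping.single a c) = c * u a"
  by (simp add: lin_ext_def)

lemma lin_ext_add: "lin_ext u (p + q) = lin_ext u p + lin_ext u q"
proof -
  let ?I = "Poly_Mapping.keys p \<union> Poly_Mapping.keys q"
  have "lin_ext u r = (\<Sum>a\<in>?I. Poly_Mapping.lookup r a * u a)"
    if "Poly_Mapping.keys r \<subseteq> ?I" for r
    using that by (intro lin_ext_superset) auto
  then show ?thesis
    using keys_add[of p q] by (simp add: lookup_add sum.distrib distrib_right)
qed

lemma lin_ext_uminus: "lin_ext u (- p) = - lin_ext u p"
  using lin_ext_add[of u p "- p"] by (simp add: eq_neg_iff_add_eq_0 add.commute)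

lemma lin_ext_diff: "lin_ext u (p - q) = lin_ext u p - lin_ext u q"
  using lin_ext_add[of u p "- q"] by (simp add: lin_ext_uminus)

lemma lin_ext_sum: "lin_ext u (\<Sum>i\<in>I. f i) = (\<Sum>i\<in>I. lin_ext u (f i))"
  by (induction I rule: infinite_finite_induct) (auto simp: lin_ext_add)

lemma lin_ext_scale: "lin_ext u (Poly_Mapping.single 0 c * p) = c * lin_ext u (p :: 'a::monoid_add \<Rightarrow>\<^sub>0 _)"
  by (induction p rule: poly_mapping_additive_induct)
     (auto simp: mult_single distrib_left lin_ext_add)

lemma lin_ext_mult:
  fixes p q :: "'a::monoid_add \<Rightarrow>\<^sub>0 'b::comm_ring_1"
  assumes "\<And>a b. u (a + b) = u a * u b"
  shows "lin_ext u (p * q) = lin_ext u p * lin_ext u q"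
proof (induction p rule: poly_mapping_additive_induct)
  case (single a c)
  show ?case
    by (induction q rule: poly_mapping_additive_induct)
       (auto simp: mult_single distrib_left lin_ext_add assms)
qed (auto simp: distrib_right lin_ext_add)

lemma riesz_eq_lin_ext: "riesz = lin_ext"
  by (intro ext) (simp add: riesz_def lin_ext_def)

lemma x_eval_eq_lin_ext: "x_eval p x = lin_ext (\<lambda>\<alpha>. x_monom \<alpha> x) p"
  by (simp add: x_eval_def lin_ext_def)

lemma x_monom_zero [simp]: "x_monom 0 x = 1"
  by (simp add: x_monom_def)

lemma x_monom_add: "x_monom (\<alpha> + \<beta>) x = x_monom \<alpha> x * x_monom \<beta> x"
  by (simp add: x_monom_def power_add prod.distrib)

lemma x_eval_simps [simp]:
  "x_eval 0 x = 0" "x_eval 1 x = 1" "x_eval (Poly_Mapping.single \<alpha> c) x = c * x_monom \<alpha> x"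
  "x_eval (p + q) x = x_eval p x + x_eval q x" "x_eval (p - q) x = x_eval p x - x_eval q x"
  "x_eval (p * q) x = x_eval p x * x_eval q x"
  "x_eval (\<Sum>i\<in>I. f i) x = (\<Sum>i\<in>I. x_eval (f i) x)"
  unfolding x_eval_eq_lin_ext single_one[symmetric]
  by (simp_all add: lin_ext_add lin_ext_diff lin_ext_sum lin_ext_mult x_monom_add del: single_one)

lemma x_eval_power [simp]: "x_eval (p ^ k) x = x_eval p x ^ k"
  by (induction k) auto

lemma continuous_on_x_monom [continuous_intros]: "continuous_on S (x_monom \<alpha>)"
  unfolding x_monom_def[abs_def] by (intro continuous_intros)

lemma continuous_on_x_eval [continuous_intros]: "continuous_on S (x_eval p)"
  unfolding x_eval_def[abs_def] by (intro continuous_intros)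

lemma continuous_on_x_grad [continuous_intros]: "continuous_on S (x_grad p)"
  unfolding x_grad_def[abs_def] by (intro continuous_intros)

lemma has_derivative_x_monom:
  "(x_monom \<alpha> has_derivative (\<lambda>h. \<Sum>i\<in>UNIV. h $ i * (real (\<alpha> $ i) * x_monom (\<alpha> - axis i 1) x))) (at x)"
proof -
  have drv: "(x_monom \<alpha> has_derivative (\<lambda>h. \<Sum>i\<in>UNIV. (real (\<alpha> $ i) * h $ i * x $ i ^ (\<alpha> $ i - 1)) *
      (\<Prod>k\<in>UNIV - {i}. x $ k ^ (\<alpha> $ k)))) (at x)"
    unfolding x_monom_def[abs_def]
    by (rule has_derivative_prod)
       (auto intro!: derivative_eq_intros bounded_linear_imp_has_derivative bounded_linear_vec_nth)
  have "x_monom (\<alpha> - axis i 1) x = x $ i ^ (\<alpha> $ i - 1) * (\<Prod>k\<in>UNIV - {i}. x $ k ^ (\<alpha> $ k))" for i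
    unfolding x_monom_def
    by (subst prod.remove[of UNIV i]) (auto simp: axis_def intro!: prod.cong)
  then show ?thesis
    by (intro has_derivative_eq_rhs[OF drv]) (simp add: mult_ac)
qed

text \<open>Identifies the formal gradient with the analytic one, which is what connects the hypothesis on
\<open>x_grad\<close> to the geometry of level sets.\<close>

lemma has_derivative_x_eval: "(x_eval p has_derivative (\<lambda>h. \<Sum>i\<in>UNIV. h $ i * x_grad p x $ i)) (at x)"
proof -
  have "(x_eval p has_derivative (\<lambda>h. \<Sum>\<alpha>\<in>Poly_Mapping.keys p. Poly_Mapping.lookup p \<alpha> *
      (\<Sum>i\<in>UNIV. h $ i * (real (\<alpha> $ i) * x_monom (\<alpha> - axis i 1) x)))) (at x)"
    unfolding x_eval_def[abs_def]
    by (intro has_derivative_sum has_derivative_mult_right has_derivative_x_monom)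
  then show ?thesis
    by (rule has_derivative_eq_rhs)
       (auto simp: x_grad_def x_partial_def sum_distrib_left sum.swap[of _ "Poly_Mapping.keys p"]
         mult_ac intro!: sum.cong ext)
qed

text \<open>The coordinate functions separate points, so the Stone-Weierstrass theorem applies to the
polynomials.\<close>

lemma x_eval_uniformly_dense:
  fixes S :: "(real ^ 'n) set"
  assumes "compact S" "continuous_on S f" "e > 0"
  shows "\<exists>p. \<forall>x\<in>S. \<bar>f x - x_eval p x\<bar> < e"
proof -
  interpret function_ring_on "range x_eval" S
  proof
    fix f h :: "real ^ 'n \<Rightarrow> real" assume "f \<in> range x_eval" "h \<in> range x_eval"
    then obtain p q where "f = x_eval p" "h = x_eval q" by auto
    then have "(\<lambda>x. f x + h x) = x_eval (p + q)" "(\<lambda>x. f x * h x) = x_eval (p * q)" by auto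
    then show "(\<lambda>x. f x + h x) \<in> range x_eval" "(\<lambda>x. f x * h x) \<in> range x_eval" by auto
  next
    fix c :: real
    have "(\<lambda>_. c) = x_eval (Poly_Mapping.single 0 c)" by auto
    then show "(\<lambda>_. c) \<in> range x_eval" by blast
  next
    fix x y :: "real ^ 'n" assume "x \<noteq> y"
    then obtain i where "x $ i \<noteq> y $ i" by (auto simp: vec_eq_iff)
    moreover have "x_monom (axis i 1) z = z $ i" for z :: "real ^ 'n"
      unfolding x_monom_def by (subst prod.remove[of UNIV i]) (auto simp: axis_def)
    ultimately show "\<exists>f\<in>range x_eval. f x \<noteq> f y"
      by (intro bexI[of _ "x_eval (Poly_Mapping.single (axis i 1) 1)"]) auto
  qed (use assms in \<open>auto intro: continuous_on_x_eval\<close>)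
  show ?thesis using Stone_Weierstrass_basic[OF assms(2,3)] by auto
qed


section \<open>Hausdorff measure of regular level sets\<close>

lemma hausdorff_content_finite_cover_le:
  fixes S :: "'a::metric_space set"
  assumes "finite I" "S \<subseteq> (\<Union>i\<in>I. D i)"
    and D: "\<And>i. i \<in> I \<Longrightarrow> bounded (D i)" "\<And>i. i \<in> I \<Longrightarrow> diameter (D i) \<le> r" and "0 \<le> r" "r \<le> \<delta>"
  shows "hausdorff_content s \<delta> S \<le> ennreal (real (card I) * (unit_ball_vol (real s) * (r / 2) ^ s))"
proof -
  let ?G = "unit_ball_vol (real s) * (r / 2) ^ s"
  have G: "0 \<le> ?G" using assms by simp
  obtain e where e: "bij_betw e {..<card I} I"
    using ex_bij_betw_nat_finite[OF \<open>finite I\<close>] by (auto simp: atLeast0LessThan)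
  define C where "C k = (if k < card I then D (e k) else {})" for k
  have eI: "e k \<in> I" if "k < card I" for k using e that by (auto simp: bij_betw_def)
  have C: "bounded (C k) \<and> diameter (C k) \<le> \<delta>" for k
    using D[OF eI, of k] assms by (auto simp: C_def)
  have cov: "S \<subseteq> (\<Union>k. C k)"
  proof
    fix x assume "x \<in> S"
    then obtain i where i: "i \<in> I" "x \<in> D i" using assms by auto
    then obtain k where "k < card I" "e k = i" using e by (metis bij_betw_iff_bijections lessThan_iff)
    with i show "x \<in> (\<Union>k. C k)" by (auto simp: C_def intro!: exI[of _ k])
  qed
  have gauge: "hausdorff_gauge s (C k) \<le> ennreal ?G" for k
  proof (cases "k < card I")
    case True
    have "0 \<le> diameter (D (e k))" using D[OF eI[OF True]] by (intro diameter_ge_0)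
    then show ?thesis
      using D[OF eI[OF True]] True
      by (auto simp: hausdorff_gauge_def C_def intro!: ennreal_leI mult_left_mono power_mono)
  qed (simp add: C_def hausdorff_gauge_def)
  have "hausdorff_content s \<delta> S \<le> suminf (\<lambda>k. hausdorff_gauge s (C k))"
    unfolding hausdorff_content_def using C cov by (intro INF_lower) auto
  also have "\<dots> = (\<Sum>k<card I. hausdorff_gauge s (C k))"
    by (intro suminf_finite) (auto simp: C_def hausdorff_gauge_def)
  also have "\<dots> \<le> (\<Sum>k<card I. ennreal ?G)" by (intro sum_mono gauge)
  also have "\<dots> = ennreal (real (card I) * ?G)" using G by (simp add: ennreal_mult ennreal_of_nat_eq_real_of_nat)
  finally show ?thesis .
qed

text \<open>Such a set is the graph of a Lipschitz function of the coordinates other than \<open>i\<close>. A grid of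
\<open>N\<^sup>n\<^sup>-\<^sup>1\<close> cells in these coordinates splits it into pieces of diameter of order \<open>1 / N\<close>, so the
\<open>(n - 1)\<close>-dimensional gauges of the pieces have a sum bounded independently of \<open>N\<close>.\<close>

lemma hausdorff_outer_finite_graph_like:
  fixes S :: "(real ^ 'n) set" and i :: "'n::finite"
  assumes "bounded S" and "0 \<le> K"
    and lip: "\<And>x y r. x \<in> S \<Longrightarrow> y \<in> S \<Longrightarrow> (\<And>k. k \<noteq> i \<Longrightarrow> \<bar>x $ k - y $ k\<bar> \<le> r) \<Longrightarrow> 0 \<le> r \<Longrightarrow> dist x y \<le> K * r"
  shows "hausdorff_outer (CARD('n) - 1) S < \<infinity>"
proof -
  let ?s = "CARD('n) - 1"
  obtain B where B: "\<And>x. x \<in> S \<Longrightarrow> norm x \<le> B" using \<open>bounded S\<close> by (auto simp: bounded_iff)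
  \<comment> \<open>Each coordinate range fits into \<open>[- \<bar>B\<bar>, - \<bar>B\<bar> + W)\<close>; the added 1 keeps the right end point
    out, so that rescaled coordinates lie in \<open>[0, 1)\<close> and cell numbers stay below \<open>N\<close>.\<close>
  define W where "W = 2 * \<bar>B\<bar> + 1"
  have W: "W > 0" by (simp add: W_def)
  have coord: "0 \<le> (x $ k + \<bar>B\<bar>) / W" "(x $ k + \<bar>B\<bar>) / W < 1" if "x \<in> S" for x k
    using component_le_norm_cart[of x k] B[OF that] W by (auto simp: W_def field_simps)
  define M where "M = unit_ball_vol (real ?s) * (K * W / 2) ^ ?s"
  have "hausdorff_content ?s \<delta> S \<le> ennreal M" if "\<delta> > 0" for \<delta>
  proof -
    obtain N where N: "K * W / \<delta> < real N" using reals_Archimedean2 by blast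
    have N0: "N > 0" using N \<open>0 \<le> K\<close> W that
      by (metis divide_nonneg_pos mult_nonneg_nonneg not_gr_zero not_le of_nat_0 less_imp_le)
    define cell where "cell x = (\<lambda>k\<in>UNIV - {i}. nat \<lfloor>(x $ k + \<bar>B\<bar>) / W * N\<rfloor>)" for x :: "real ^ 'n"
    define I where "I = PiE (UNIV - {i}) (\<lambda>_. {..<N})"
    define D where "D c = {x \<in> S. cell x = c}" for c
    have cardI: "card I = N ^ ?s" by (simp add: I_def card_PiE)
    have cellI: "cell x \<in> I" if "x \<in> S" for x
    proof -
      have "nat \<lfloor>(x $ k + \<bar>B\<bar>) / W * N\<rfloor> < N" for k
      proof -
        have "(x $ k + \<bar>B\<bar>) / W * N < 1 * real N" using coord[OF that, of k] N0 by (intro mult_strict_right_mono) auto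
        then have "\<lfloor>(x $ k + \<bar>B\<bar>) / W * N\<rfloor> < int N" by (simp add: floor_less_iff)
        then show ?thesis using N0 by linarith
      qed
      then show ?thesis by (auto simp: cell_def I_def)
    qed
    have dist: "dist x y \<le> K * (W / N)" if "x \<in> D c" "y \<in> D c" for x y c
    proof (rule lip)
      fix k assume "k \<noteq> i"
      let ?a = "(x $ k + \<bar>B\<bar>) / W * N" and ?b = "(y $ k + \<bar>B\<bar>) / W * N"
      have S: "x \<in> S" "y \<in> S" and eq: "cell x = cell y" using that by (auto simp: D_def)
      have "nat \<lfloor>?a\<rfloor> = nat \<lfloor>?b\<rfloor>" using fun_cong[OF eq, of k] \<open>k \<noteq> i\<close> by (simp add: cell_def)
      moreover have "0 \<le> ?a" "0 \<le> ?b"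
        using coord(1)[OF S(1), of k] coord(1)[OF S(2), of k] by (intro mult_nonneg_nonneg; simp)+
      ultimately have "\<lfloor>?a\<rfloor> = \<lfloor>?b\<rfloor>" by (metis eq_nat_nat_iff zero_le_floor)
      then have "\<bar>?a - ?b\<bar> \<le> 1" by linarith
      also have "?a - ?b = (x $ k - y $ k) * (N / W)" using W by (simp add: field_simps)
      finally have "\<bar>x $ k - y $ k\<bar> * (N / W) \<le> 1" using W by (simp only: abs_mult) simp
      then show "\<bar>x $ k - y $ k\<bar> \<le> W / N" using W N0 by (simp add: field_simps)
    qed (use that W in \<open>auto simp: D_def\<close>)
    have "hausdorff_content ?s \<delta> S \<le>
        ennreal (real (card I) * (unit_ball_vol (real ?s) * (K * (W / N) / 2) ^ ?s))"
    proof (rule hausdorff_content_finite_cover_le[where D = D])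
      show "finite I" by (simp add: I_def finite_PiE)
      show "S \<subseteq> (\<Union>c\<in>I. D c)" using cellI by (auto simp: D_def)
      show "bounded (D c)" for c using \<open>bounded S\<close> by (rule bounded_subset) (auto simp: D_def)
      show "diameter (D c) \<le> K * (W / N)" for c
        using dist \<open>0 \<le> K\<close> W by (intro diameter_le) (auto simp: dist_norm)
      show "0 \<le> K * (W / N)" using \<open>0 \<le> K\<close> W by simp
      show "K * (W / N) \<le> \<delta>" using N N0 that by (simp add: field_simps)
    qed
    also have "real (card I) * (unit_ball_vol (real ?s) * (K * (W / N) / 2) ^ ?s) = M"
    proof -
      have "real N * (K * (W / N) / 2) = K * W / 2" using N0 by simp
      then have "real N ^ ?s * (K * (W / N) / 2) ^ ?s = (K * W / 2) ^ ?s"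
        by (simp only: power_mult_distrib[symmetric])
      then show ?thesis unfolding M_def cardI of_nat_power by (simp only: mult.left_commute)
    qed
    finally show ?thesis .
  qed
  then have "hausdorff_outer ?s S \<le> ennreal M"
    unfolding hausdorff_outer_def by (intro SUP_least) auto
  then show ?thesis by (simp add: le_less_trans)
qed

text \<open>Near \<open>x0\<close> some partial derivative \<open>\<partial>\<^sub>i p\<close> stays away from 0 and the gradient stays bounded. By the
mean value theorem along the segment between two points of the level set, their difference is
orthogonal to a gradient nearby, so its \<open>i\<close>-th coordinate is bounded by the others.\<close>

lemma x_eval_level_set_locally_finite:
  fixes p :: "'n::finite xpoly" and x0 :: "real ^ 'n"
  assumes "x_grad p x0 \<noteq> 0"
  shows "\<exists>r>0. hausdorff_outer (CARD('n) - 1) ({x. x_eval p x = c} \<inter> ball x0 r) < \<infinity>"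
proof -
  obtain i where i: "x_grad p x0 $ i \<noteq> 0" using assms by (auto simp: vec_eq_iff)
  define a where "a = \<bar>x_grad p x0 $ i\<bar> / 2"
  have a: "a > 0" using i by (simp add: a_def)
  have cont: "continuous_on UNIV (\<lambda>x. \<bar>x_grad p x $ i\<bar>)" by (intro continuous_intros)
  then have "open {x. a < \<bar>x_grad p x $ i\<bar>}" by (intro open_Collect_less continuous_intros)
  moreover have "x0 \<in> {x. a < \<bar>x_grad p x $ i\<bar>}" using i by (simp add: a_def)
  ultimately obtain r where r: "r > 0" "ball x0 r \<subseteq> {x. a < \<bar>x_grad p x $ i\<bar>}"
    by (meson open_contains_ball)
  have "bounded (x_grad p ` cball x0 r)"
    by (intro compact_imp_bounded compact_continuous_image continuous_on_x_grad compact_cball)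
  then obtain G where G: "\<And>x. x \<in> cball x0 r \<Longrightarrow> norm (x_grad p x) \<le> G"
    unfolding bounded_iff by blast
  have G0: "0 \<le> G" using G[of x0] r norm_ge_zero order_trans by (metis centre_in_cball less_imp_le)
  let ?n = "real CARD('n)"
  have "hausdorff_outer (CARD('n) - 1) ({x. x_eval p x = c} \<inter> ball x0 r) < \<infinity>"
  proof (rule hausdorff_outer_finite_graph_like[where i = i])
    fix x y :: "real ^ 'n" and t
    assume x: "x \<in> {x. x_eval p x = c} \<inter> ball x0 r" and y: "y \<in> {x. x_eval p x = c} \<inter> ball x0 r"
      and le: "\<And>k. k \<noteq> i \<Longrightarrow> \<bar>x $ k - y $ k\<bar> \<le> t" and t: "0 \<le> t"
    let ?z = "\<lambda>s. y + s *\<^sub>R (x - y)"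
    have "((\<lambda>s. x_eval p (?z s)) has_derivative
        (\<lambda>h. \<Sum>k\<in>UNIV. (h *\<^sub>R (x - y)) $ k * x_grad p (?z s) $ k)) (at s within {0..1})" for s
      by (rule has_derivative_compose[OF _ has_derivative_x_eval]) (auto intro!: derivative_eq_intros)
    then obtain s where s: "s \<in> {0<..<1}" and mvt: "x_eval p (?z 1) - x_eval p (?z 0) =
        (\<Sum>k\<in>UNIV. ((1 - 0) *\<^sub>R (x - y)) $ k * x_grad p (?z s) $ k)"
      using mvt_simple[of 0 1 "\<lambda>s. x_eval p (?z s)"
          "\<lambda>s h. \<Sum>k\<in>UNIV. (h *\<^sub>R (x - y)) $ k * x_grad p (?z s) $ k"] by auto
    have "?z s = (1 - s) *\<^sub>R y + s *\<^sub>R x" by (simp add: algebra_simps)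
    then have z: "?z s \<in> ball x0 r"
      using convexD[OF convex_ball, of y x0 r x "1 - s" s] x y s by auto
    let ?D = "x_grad p (?z s)"
    have D: "\<bar>?D $ k\<bar> \<le> G" for k
      using G[of "?z s"] z component_le_norm_cart[of ?D k] by (meson ball_subset_cball in_mono order_trans)
    have "(\<Sum>k\<in>UNIV. (x $ k - y $ k) * ?D $ k) = 0" using mvt x y by simp
    moreover have "(\<Sum>k\<in>UNIV. (x $ k - y $ k) * ?D $ k) =
        (x $ i - y $ i) * ?D $ i + (\<Sum>k\<in>UNIV - {i}. (x $ k - y $ k) * ?D $ k)"
      by (rule sum.remove) auto
    ultimately have "(x $ i - y $ i) * ?D $ i = - (\<Sum>k\<in>UNIV - {i}. (x $ k - y $ k) * ?D $ k)"
      by linarith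
    then have "\<bar>x $ i - y $ i\<bar> * \<bar>?D $ i\<bar> = \<bar>\<Sum>k\<in>UNIV - {i}. (x $ k - y $ k) * ?D $ k\<bar>"
      by (simp only: abs_mult[symmetric] abs_minus_cancel)
    also have "\<dots> \<le> (\<Sum>k\<in>UNIV - {i}. \<bar>x $ k - y $ k\<bar> * \<bar>?D $ k\<bar>)"
      by (rule order_trans[OF sum_abs]) (simp add: abs_mult)
    also have "\<dots> \<le> (\<Sum>k\<in>UNIV - {i}. t * G)"
      using le D t by (intro sum_mono mult_mono) auto
    also have "\<dots> \<le> ?n * (t * G)" using t G0
      by (simp only: sum_constant) (intro mult_right_mono, simp_all)
    finally have "\<bar>x $ i - y $ i\<bar> * \<bar>?D $ i\<bar> \<le> ?n * (t * G)" .
    moreover have "\<bar>x $ i - y $ i\<bar> * a \<le> \<bar>x $ i - y $ i\<bar> * \<bar>?D $ i\<bar>"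
      using r z by (intro mult_left_mono) auto
    ultimately have xi: "\<bar>x $ i - y $ i\<bar> \<le> ?n * (t * G) / a" using a by (simp add: field_simps)
    have "dist x y \<le> (\<Sum>k\<in>UNIV. \<bar>x $ k - y $ k\<bar>)"
      using norm_le_l1_cart[of "x - y"] by (simp add: dist_norm)
    also have "\<dots> = \<bar>x $ i - y $ i\<bar> + (\<Sum>k\<in>UNIV - {i}. \<bar>x $ k - y $ k\<bar>)"
      by (rule sum.remove) auto
    also have "\<dots> \<le> ?n * (t * G) / a + (\<Sum>k\<in>UNIV - {i}. t)"
      using le by (intro add_mono xi sum_mono) auto
    also have "\<dots> \<le> ?n * (t * G) / a + ?n * t" using t
      by (simp only: sum_constant add_le_cancel_left) (intro mult_right_mono, simp_all)
    finally show "dist x y \<le> (?n * G / a + ?n) * t" by (simp add: algebra_simps)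
  next
    show "bounded ({x. x_eval p x = c} \<inter> ball x0 r)" by (intro bounded_Int) auto
    show "0 \<le> ?n * G / a + ?n" using a G0 by (intro add_nonneg_nonneg divide_nonneg_pos) auto
  qed
  with r show ?thesis by auto
qed

lemma hausdorff_outer_finite_compact:
  assumes "compact K" and loc: "\<And>x. x \<in> K \<Longrightarrow> \<exists>r>0. hausdorff_outer s (K \<inter> ball x r) < \<infinity>"
  shows "hausdorff_outer s K < \<infinity>"
proof -
  obtain r where r: "\<And>x. x \<in> K \<Longrightarrow> r x > 0 \<and> hausdorff_outer s (K \<inter> ball x (r x)) < \<infinity>"
    using loc by metis
  have "K \<subseteq> (\<Union>x\<in>K. ball x (r x))" using r by force
  then obtain F where F: "F \<subseteq> K" "finite F" "K \<subseteq> (\<Union>x\<in>F. ball x (r x))"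
    using compactE_image[OF \<open>compact K\<close>, of K "\<lambda>x. ball x (r x)"] by auto
  have "hausdorff_outer s (\<Union>x\<in>F. K \<inter> ball x (r x)) < \<infinity>"
    using F(2,1)
  proof (induction F)
    case (insert x F)
    then show ?case
      using r[of x] hausdorff_outer_Un_le[of s "K \<inter> ball x (r x)" "\<Union>x\<in>F. K \<inter> ball x (r x)"]
      by (auto intro: le_less_trans simp: less_top)
  qed simp
  moreover have "K = (\<Union>x\<in>F. K \<inter> ball x (r x))" using F by auto
  ultimately show ?thesis by simp
qed

lemma hausdorff_outer_regular_level_set_finite:
  fixes p :: "'n::finite xpoly" and K :: "(real ^ 'n) set"
  assumes "compact K" "\<And>x. x \<in> K \<Longrightarrow> x_eval p x = c" "\<And>x. x \<in> K \<Longrightarrow> x_grad p x \<noteq> 0"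
  shows "hausdorff_outer (CARD('n) - 1) K < \<infinity>"
proof (rule hausdorff_outer_finite_compact[OF \<open>compact K\<close>])
  fix x assume "x \<in> K"
  then obtain r where r: "r > 0" "hausdorff_outer (CARD('n) - 1) ({x. x_eval p x = c} \<inter> ball x r) < \<infinity>"
    using x_eval_level_set_locally_finite assms by blast
  have "K \<inter> ball x r \<subseteq> {x. x_eval p x = c} \<inter> ball x r" using assms(2) by auto
  then show "\<exists>r>0. hausdorff_outer (CARD('n) - 1) (K \<inter> ball x r) < \<infinity>"
    using r hausdorff_outer_mono le_less_trans by blast
qed


section \<open>Moment matrices and the Riesz functional\<close>

text \<open>The discriminant criterion, which includes the degenerate case \<open>C = 0\<close>.\<close>

lemma square_le_of_quadratic_nonneg:
  fixes A B C :: real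
  assumes "\<And>t. 0 \<le> A + 2 * t * B + t\<^sup>2 * C" and "0 \<le> C"
  shows "B\<^sup>2 \<le> A * C"
proof (cases "C = 0")
  case True
  have "B = 0"
  proof (rule ccontr)
    assume "B \<noteq> 0"
    then show False using assms(1)[of "- (A + 1) / (2 * B)"] True by (simp add: field_simps)
  qed
  then show ?thesis using True by simp
next
  case False
  with \<open>0 \<le> C\<close> have "C > 0" by simp
  then show ?thesis using assms(1)[of "- B / C"] by (simp add: field_simps power2_eq_square)
qed

lemma riesz_simps [simp]:
  "riesz u 0 = 0" "riesz u (Poly_Mapping.single a c) = c * u a"
  "riesz u (p + q) = riesz u p + riesz u q" "riesz u (p - q) = riesz u p - riesz u q"
  "riesz u (\<Sum>i\<in>I. f i) = (\<Sum>i\<in>I. riesz u (f i))"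
  "riesz u (Poly_Mapping.single 0 c * p) = c * riesz u p"
  by (simp_all add: riesz_eq_lin_ext lin_ext_add lin_ext_diff lin_ext_sum lin_ext_scale)

lemma keys_mult_single_0:
  fixes p :: "'a::monoid_add \<Rightarrow>\<^sub>0 'b::semiring_0"
  shows "Poly_Mapping.keys (Poly_Mapping.single 0 c * p) \<subseteq> Poly_Mapping.keys p"
  using keys_mult[of "Poly_Mapping.single 0 c" p] by (auto split: if_splits)

text \<open>Relates the quadratic form of a localizing matrix to the Riesz functional, so that
semidefiniteness becomes nonnegativity on multiples of squares.\<close>

lemma riesz_times_square:
  fixes p q :: "'n::finite xzpoly"
  assumes "finite I" "Poly_Mapping.keys p \<subseteq> I"
  shows "riesz u (q * (p * p)) =
    (\<Sum>a\<in>I. \<Sum>b\<in>I. Poly_Mapping.lookup p a * local_matrix q u a b * Poly_Mapping.lookup p b)"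
proof -
  let ?s = "\<lambda>a. Poly_Mapping.single a (Poly_Mapping.lookup p a)"
  have mono: "riesz u (q * (?s a * ?s b)) = Poly_Mapping.lookup p a * local_matrix q u a b * Poly_Mapping.lookup p b"
    for a b
  proof -
    have "q * (?s a * ?s b) =
        Poly_Mapping.single 0 (Poly_Mapping.lookup p a * Poly_Mapping.lookup p b) * (q * Poly_Mapping.single (a + b) 1)"
      by (subst mult.left_commute) (simp add: mult_single)
    then show ?thesis by (simp add: local_matrix_def)
  qed
  have "(\<Sum>a\<in>I. ?s a) = p" by (rule poly_mapping_eq_sum_single[OF assms, symmetric])
  then have "q * (p * p) = q * ((\<Sum>a\<in>I. ?s a) * (\<Sum>b\<in>I. ?s b))" by (simp only:)
  also have "\<dots> = (\<Sum>a\<in>I. \<Sum>b\<in>I. q * (?s a * ?s b))"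
    unfolding sum_product unfolding sum_distrib_left ..
  finally show ?thesis by (simp add: mono)
qed

lemma riesz_times_square_nonneg:
  assumes "psd_on (xz_exps k) (local_matrix q u)" "Poly_Mapping.keys p \<subseteq> xz_exps k"
  shows "0 \<le> riesz u (q * (p * p))"
  using assms riesz_times_square[OF finite_xz_exps assms(2), of u q] by (simp add: psd_on_def)

text \<open>The row of the matrix with index 0 already contains all the values needed.\<close>

lemma riesz_times_eq_0:
  assumes "zero_on (xz_exps k) (local_matrix t u)" "Poly_Mapping.keys q \<subseteq> xz_exps k"
  shows "riesz u (t * q) = 0"
proof -
  have 0: "riesz u (t * Poly_Mapping.single a c) = 0" if "a \<in> Poly_Mapping.keys q" for a c
  proof -
    have "t * Poly_Mapping.single a c = Poly_Mapping.single 0 c * (t * Poly_Mapping.single (a + 0) 1)"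
      by (subst mult.left_commute) (simp add: mult_single)
    moreover have "(0 :: 'a exps \<times> nat) \<in> xz_exps k"
      by (simp add: xz_exps_def exps_abs_def zero_prod_def)
    ultimately show ?thesis
      using assms that unfolding zero_on_def local_matrix_def by (metis in_mono mult_zero_right riesz_simps(6))
  qed
  show ?thesis
    by (subst poly_mapping_eq_sum_single[OF finite_keys order_refl, of q])
       (simp add: sum_distrib_left 0)
qed

lemma square_of_linear_combination:
  fixes p q t :: "'a::comm_ring_1"
  shows "(p + t * q) * (p + t * q) = p * p + 2 * t * (p * q) + t\<^sup>2 * (q * q)"
  by (simp add: algebra_simps power2_eq_square)

text \<open>The functional is nonnegative on the squares of \<open>p + t q\<close> for all real \<open>t\<close>.\<close>

lemma riesz_cauchy_schwarz:
  assumes M: "psd_on (xz_exps k) (local_matrix 1 u)"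
    and p: "Poly_Mapping.keys p \<subseteq> xz_exps k" and q: "Poly_Mapping.keys q \<subseteq> xz_exps k"
  shows "(riesz u (p * q))\<^sup>2 \<le> riesz u (p * p) * riesz u (q * q)"
proof (rule square_le_of_quadratic_nonneg)
  show "0 \<le> riesz u (q * q)" using riesz_times_square_nonneg[OF M q] by simp
  fix t
  let ?r = "p + Poly_Mapping.single 0 t * q"
  have "Poly_Mapping.keys ?r \<subseteq> xz_exps k"
    using keys_add[of p "Poly_Mapping.single 0 t * q"] keys_mult_single_0[of t q] p q by blast
  then have "0 \<le> riesz u (?r * ?r)" using riesz_times_square_nonneg[OF M] by fastforce
  also have "?r * ?r = p * p + Poly_Mapping.single 0 (2 * t) * (p * q) + Poly_Mapping.single 0 (t\<^sup>2) * (q * q)"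
  proof -
    have "Poly_Mapping.single 0 (2 * t) = 2 * Poly_Mapping.single (0 :: 'a exps \<times> nat) t"
      "Poly_Mapping.single 0 (t\<^sup>2) = (Poly_Mapping.single (0 :: 'a exps \<times> nat) t)\<^sup>2"
      by (simp_all only: power2_eq_square mult_single mult_2 single_add add_0_left)
    then show ?thesis by (simp only: square_of_linear_combination)
  qed
  finally show "0 \<le> riesz u (p * p) + 2 * t * riesz u (p * q) + t\<^sup>2 * riesz u (q * q)"
    by (simp only: riesz_simps)
qed

text \<open>From \<open>(z - s\<^sup>2)\<^sup>2 = (z + s\<^sup>2)\<^sup>2 - 4 z s\<^sup>2\<close> and \<open>(z - s\<^sup>2)(z + s\<^sup>2) = z\<^sup>2 - s\<^sup>4\<close>. The right-hand
side is arranged so that a functional vanishing on multiples of \<open>z\<^sup>2 - f\<close> and nonnegative on \<open>z\<close>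
times squares sees at most the term \<open>(f - s\<^sup>4)\<^sup>2\<close>, in which \<open>z\<close> does not occur.\<close>

lemma power4_root_difference:
  fixes f s z :: "'a::comm_ring_1"
  defines "w \<equiv> z - s * s"
  shows "w * w * (w * w) =
    (z ^ 2 - f) * (z ^ 2 - f + 2 * (f - s ^ 4)) + (f - s ^ 4)\<^sup>2 - 4 * (z * (s * w * (s * w)))"
proof -
  define t where "t = z ^ 2 - f"
  define r where "r = f - s ^ 4"
  have ww: "w * w = (z + s * s) * (z + s * s) - 4 * (z * (s * s))"
    unfolding w_def by (simp add: algebra_simps)
  have tr: "w * (z + s * s) = t + r"
    unfolding w_def t_def r_def by (simp add: algebra_simps power2_eq_square power4_eq_xxxx)
  have "w * w * (w * w) = w * w * ((z + s * s) * (z + s * s) - 4 * (z * (s * s)))"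
    by (simp only: ww)
  also have "\<dots> = (w * (z + s * s)) * (w * (z + s * s)) - 4 * (z * (s * w * (s * w)))"
    by (simp only: right_diff_distrib mult_ac)
  also have "\<dots> = t * (t + 2 * r) + r\<^sup>2 - 4 * (z * (s * w * (s * w)))"
    unfolding tr by (simp add: algebra_simps power2_eq_square)
  finally show ?thesis by (simp only: t_def r_def)
qed

text \<open>The core of the argument: if the functional is positive, treats \<open>z\<^sup>2\<close> as \<open>F\<close> and \<open>z\<close> as
nonnegative, then \<open>z\<close> may be replaced by \<open>S\<^sup>2\<close> up to an error governed by \<open>F - S\<^sup>4\<close>. Two
applications of the Cauchy-Schwarz inequality reduce the claim to the functional at
\<open>(z - S\<^sup>2)\<^sup>4\<close>, which is bounded by the preceding identity.\<close>

lemma riesz_root_estimate: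
  fixes S F Q :: "'n::finite xzpoly" and u :: "'n exps \<times> nat \<Rightarrow> real"
  defines "W \<equiv> xz_z - S * S"
  assumes M: "psd_on (xz_exps d) (local_matrix 1 u)"
    and Z: "psd_on (xz_exps k) (local_matrix xz_z u)"
    and T: "zero_on (xz_exps l) (local_matrix (xz_z ^ 2 - F) u)"
    and keys: "Poly_Mapping.keys Q \<subseteq> xz_exps d" "Poly_Mapping.keys W \<subseteq> xz_exps d"
      "Poly_Mapping.keys (1 :: 'n xzpoly) \<subseteq> xz_exps d" "Poly_Mapping.keys (W * W) \<subseteq> xz_exps d"
      "Poly_Mapping.keys (S * W) \<subseteq> xz_exps k"
      "Poly_Mapping.keys (xz_z ^ 2 - F + 2 * (F - S ^ 4)) \<subseteq> xz_exps l"
  shows "(riesz u (Q * W)) ^ 4 \<le> (riesz u (Q * Q))\<^sup>2 * (riesz u 1 * riesz u ((F - S ^ 4)\<^sup>2))"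
proof -
  have sq: "0 \<le> riesz u (p * p)" if "Poly_Mapping.keys p \<subseteq> xz_exps d" for p
    using riesz_times_square_nonneg[OF M that] by simp
  have "W * W * (W * W) = (xz_z ^ 2 - F) * (xz_z ^ 2 - F + 2 * (F - S ^ 4)) + (F - S ^ 4)\<^sup>2
      - Poly_Mapping.single 0 4 * (xz_z * (S * W * (S * W)))"
    unfolding W_def single_numeral by (rule power4_root_difference)
  then have "riesz u (W * W * (W * W)) = riesz u ((F - S ^ 4)\<^sup>2) - 4 * riesz u (xz_z * (S * W * (S * W)))"
    using riesz_times_eq_0[OF T keys(6)] by (simp only: riesz_simps)
  then have W4: "riesz u (W * W * (W * W)) \<le> riesz u ((F - S ^ 4)\<^sup>2)"
    using riesz_times_square_nonneg[OF Z keys(5)] by simp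
  have "(riesz u (1 * (W * W)))\<^sup>2 \<le> riesz u (1 * 1) * riesz u (W * W * (W * W))"
    using keys by (intro riesz_cauchy_schwarz[OF M])
  also have "\<dots> \<le> riesz u (1 * 1) * riesz u ((F - S ^ 4)\<^sup>2)"
    using sq[of 1] keys by (intro mult_left_mono W4) auto
  finally have W2: "(riesz u (W * W))\<^sup>2 \<le> riesz u 1 * riesz u ((F - S ^ 4)\<^sup>2)" by simp
  have "(riesz u (Q * W)) ^ 4 = ((riesz u (Q * W))\<^sup>2)\<^sup>2" by simp
  also have "\<dots> \<le> (riesz u (Q * Q) * riesz u (W * W))\<^sup>2"
    using keys by (intro power_mono riesz_cauchy_schwarz[OF M]) auto
  also have "\<dots> \<le> (riesz u (Q * Q))\<^sup>2 * (riesz u 1 * riesz u ((F - S ^ 4)\<^sup>2))"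
    unfolding power_mult_distrib using W2 by (intro mult_left_mono) auto
  finally show ?thesis .
qed

lemma xz_exps_mono: "k \<le> l \<Longrightarrow> xz_exps k \<subseteq> xz_exps l"
  by (auto simp: xz_exps_def)

lemma keys_subset_xz_exps_degree: "Poly_Mapping.keys p \<subseteq> xz_exps (xz_degree p)"
proof
  fix a assume "a \<in> Poly_Mapping.keys p"
  then have "(\<lambda>(\<alpha>, k). exps_abs \<alpha> + k) a \<le> xz_degree p"
    unfolding xz_degree_def by (intro Max_ge finite.insertI finite_imageI finite_keys insertI2 imageI)
  then show "a \<in> xz_exps (xz_degree p)" by (auto simp: xz_exps_def)
qed

text \<open>The estimates concern finitely many fixed polynomials. Their degree restrictions hold
for all large orders, and the subtraction of \<open>c\<close> accounts for the smaller localizing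
matrices.\<close>

lemma eventually_keys_subset_xz_exps:
  fixes p :: "'n::finite xzpoly"
  shows "eventually (\<lambda>d. Poly_Mapping.keys p \<subseteq> xz_exps (d - c)) sequentially"
proof -
  have "Poly_Mapping.keys p \<subseteq> xz_exps (d - c)" if "d \<ge> xz_degree p + c" for d
    using keys_subset_xz_exps_degree[of p] xz_exps_mono[of "xz_degree p" "d - c"] that by fastforce
  then show ?thesis by (auto simp: eventually_sequentially)
qed

lemma xz_of_x_eq_sum:
  "finite I \<Longrightarrow> Poly_Mapping.keys p \<subseteq> I \<Longrightarrow>
    xz_of_x p = (\<Sum>\<alpha>\<in>I. Poly_Mapping.single (\<alpha>, 0) (Poly_Mapping.lookup p \<alpha>))"
  unfolding xz_of_x_def by (intro sum.mono_neutral_left) (auto simp: in_keys_iff)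

lemma xz_of_x_single [simp]: "xz_of_x (Poly_Mapping.single \<alpha> c) = Poly_Mapping.single (\<alpha>, 0) c"
  by (simp add: xz_of_x_def)

lemma xz_of_x_add [simp]: "xz_of_x (p + q) = xz_of_x p + xz_of_x q"
proof -
  let ?I = "Poly_Mapping.keys p \<union> Poly_Mapping.keys q"
  have "xz_of_x r = (\<Sum>\<alpha>\<in>?I. Poly_Mapping.single (\<alpha>, 0) (Poly_Mapping.lookup r \<alpha>))"
    if "Poly_Mapping.keys r \<subseteq> ?I" for r
    using that by (intro xz_of_x_eq_sum) auto
  then show ?thesis
    using keys_add[of p q] by (simp add: lookup_add single_add sum.distrib)
qed

lemma xz_of_x_diff [simp]: "xz_of_x (p - q) = xz_of_x p - xz_of_x q"
  using xz_of_x_add[of "p - q" q] by (simp del: xz_of_x_add add: algebra_simps)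

lemma xz_of_x_mult [simp]: "xz_of_x (p * q) = xz_of_x p * xz_of_x q"
proof (induction p rule: poly_mapping_additive_induct)
  case (single a c)
  show ?case
    by (induction q rule: poly_mapping_additive_induct)
       (auto simp: mult_single distrib_left xz_of_x_def[of 0])
qed (auto simp: distrib_right xz_of_x_def[of 0])

lemma xz_of_x_one [simp]: "xz_of_x 1 = 1"
  by (metis single_one xz_of_x_single zero_prod_def)

lemma xz_of_x_power [simp]: "xz_of_x (p ^ k) = xz_of_x p ^ k"
  by (induction k) auto

lemma riesz_xz_of_x: "riesz u (xz_of_x p) = lin_ext (\<lambda>\<alpha>. u (\<alpha>, 0)) p"
  by (simp add: xz_of_x_def lin_ext_def)


section \<open>Attainment of the optimal values\<close>

lemma exps_abs_add [simp]: "exps_abs (\<alpha> + \<beta>) = exps_abs \<alpha> + exps_abs \<beta>"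
  by (simp add: exps_abs_def sum.distrib)

lemma exps_abs_zero [simp]: "exps_abs 0 = 0"
  by (simp add: exps_abs_def)

lemma exps_abs_axis [simp]: "exps_abs (axis i c) = c"
  by (simp add: exps_abs_def axis_def)

lemma xz_exps_add: "a \<in> xz_exps k \<Longrightarrow> b \<in> xz_exps l \<Longrightarrow> a + b \<in> xz_exps (k + l)"
  by (cases a; cases b) (auto simp: xz_exps_def)

lemma xz_exps_Suc_decompose:
  assumes "c \<in> xz_exps (Suc k)" "c \<notin> xz_exps k"
  obtains e c' where "e \<in> xz_exps 1" "c' \<in> xz_exps k" "c = e + c'"
proof -
  obtain \<alpha> i where c: "c = (\<alpha>, i)" and deg: "exps_abs \<alpha> + i = Suc k"
    using assms by (cases c) (auto simp: xz_exps_def)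
  show ?thesis
  proof (cases i)
    case (Suc i')
    show ?thesis
      using deg by (intro that[of "(0, 1)" "(\<alpha>, i')"]) (auto simp: xz_exps_def c Suc)
  next
    case 0
    then have "exps_abs \<alpha> \<noteq> 0" using deg by simp
    then obtain l where l: "\<alpha> $ l \<noteq> 0" by (auto simp: exps_abs_def)
    define \<beta> where "\<beta> = \<alpha> - axis l 1"
    have \<alpha>: "\<alpha> = axis l 1 + \<beta>" using l by (auto simp: \<beta>_def vec_eq_iff axis_def)
    have "exps_abs \<alpha> = Suc (exps_abs \<beta>)" by (subst \<alpha>) simp
    then show ?thesis
      using deg 0 \<alpha> by (intro that[of "(axis l 1, 0)" "(\<beta>, 0)"]) (auto simp: xz_exps_def c)
  qed
qed

text \<open>Every entry of \<open>u\<close> of degree at most \<open>2 d\<close> therefore occurs in the moment matrix of order \<open>d\<close>.\<close>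

lemma xz_exps_decompose:
  "c \<in> xz_exps (k + l) \<Longrightarrow> \<exists>a\<in>xz_exps k. \<exists>b\<in>xz_exps l. c = a + b"
proof (induction k arbitrary: l)
  case 0
  have "0 \<in> xz_exps 0" by (simp add: xz_exps_def zero_prod_def)
  then show ?case using 0 by (intro bexI[of _ 0] bexI[of _ c]) auto
next
  case (Suc k)
  then have "c \<in> xz_exps (k + Suc l)" by simp
  then obtain a b where ab: "a \<in> xz_exps k" "b \<in> xz_exps (Suc l)" "c = a + b" using Suc.IH by blast
  show ?case
  proof (cases "b \<in> xz_exps l")
    case True
    then show ?thesis using ab xz_exps_mono[of k "Suc k"] by auto
  next
    case False
    with ab(2) obtain e b' where "e \<in> xz_exps 1" "b' \<in> xz_exps l" "b = e + b'"
      by (rule xz_exps_Suc_decompose)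
    then show ?thesis
      using ab xz_exps_add[of a k e 1] by (intro bexI[of _ "a + e"] bexI[of _ b']) (auto simp: add.assoc)
  qed
qed

lemma riesz_cong:
  "(\<And>a. a \<in> Poly_Mapping.keys p \<Longrightarrow> u a = w a) \<Longrightarrow> riesz u p = riesz w p"
  by (simp add: riesz_def)

lemma local_matrix_cong:
  assumes "\<And>c. c \<in> xz_exps (2 * d) \<Longrightarrow> u c = w c"
    and "Poly_Mapping.keys p \<subseteq> xz_exps l" "l + 2 * k \<le> 2 * d"
    and "a \<in> xz_exps k" "b \<in> xz_exps k"
  shows "local_matrix p u a b = local_matrix p w a b"
  unfolding local_matrix_def
proof (rule riesz_cong)
  fix c assume "c \<in> Poly_Mapping.keys (p * Poly_Mapping.single (a + b) 1)"
  then obtain e where "e \<in> Poly_Mapping.keys p" "c = e + (a + b)"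
    using keys_mult[of p "Poly_Mapping.single (a + b) 1"] by (auto simp del: split_paired_All split_paired_Ex)
  then have "c \<in> xz_exps (l + (k + k))" using assms by (auto intro!: xz_exps_add)
  then have "c \<in> xz_exps (2 * d)" using assms(3) xz_exps_mono[of "l + (k + k)" "2 * d"] by auto
  then show "u c = w c" by (rule assms(1))
qed

lemma psd_on_cong:
  assumes "\<And>a b. a \<in> I \<Longrightarrow> b \<in> I \<Longrightarrow> M a b = M' a b" and "psd_on I M"
  shows "psd_on I M'"
proof -
  have "(\<Sum>a\<in>I. \<Sum>b\<in>I. c a * M a b * c b) = (\<Sum>a\<in>I. \<Sum>b\<in>I. c a * M' a b * c b)" for c
    using assms(1) by (intro sum.cong) auto
  then show ?thesis using assms by (simp add: psd_on_def)
qed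

lemma psd_on_subset:
  assumes "finite I" "J \<subseteq> I" "psd_on I M"
  shows "psd_on J M"
  unfolding psd_on_def
proof (intro conjI allI ballI)
  fix c :: "'a \<Rightarrow> real"
  let ?c = "\<lambda>a. if a \<in> J then c a else 0"
  have "(\<Sum>a\<in>I. \<Sum>b\<in>I. ?c a * M a b * ?c b) = (\<Sum>a\<in>J. \<Sum>b\<in>I. ?c a * M a b * ?c b)"
    using assms by (intro sum.mono_neutral_right) auto
  also have "\<dots> = (\<Sum>a\<in>J. \<Sum>b\<in>J. ?c a * M a b * ?c b)"
    using assms by (intro sum.cong sum.mono_neutral_right) auto
  finally have "(\<Sum>a\<in>I. \<Sum>b\<in>I. ?c a * M a b * ?c b) = (\<Sum>a\<in>J. \<Sum>b\<in>J. c a * M a b * c b)"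
    by simp
  moreover have "0 \<le> (\<Sum>a\<in>I. \<Sum>b\<in>I. ?c a * M a b * ?c b)"
    using assms(3) unfolding psd_on_def by (elim conjE allE[of _ ?c])
  ultimately show "0 \<le> (\<Sum>a\<in>J. \<Sum>b\<in>J. c a * M a b * c b)" by (simp only:)
qed (use assms in \<open>auto simp: psd_on_def\<close>)

lemma Q_feasible_antimono:
  assumes "d \<le> e"
  shows "Q_feasible m g b j \<tau> e \<subseteq> Q_feasible m g b j \<tau> d"
proof
  fix u assume u: "u \<in> Q_feasible m g b j \<tau> e"
  have sub: "xz_exps (d - k) \<subseteq> xz_exps (e - k)" for k using assms by (intro xz_exps_mono) auto
  have "psd_on (xz_exps d) M" if "psd_on (xz_exps e) M" for M
    using psd_on_subset[OF finite_xz_exps _ that] xz_exps_mono[OF assms] .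
  moreover have "psd_on (xz_exps (d - 1)) M" if "psd_on (xz_exps (e - 1)) M" for M
    using psd_on_subset[OF finite_xz_exps sub that] .
  moreover have "zero_on (xz_exps (d - k)) M" if "zero_on (xz_exps (e - k)) M" for k M
    using that sub by (auto simp: zero_on_def)
  ultimately show "u \<in> Q_feasible m g b j \<tau> d"
    using u assms unfolding Q_feasible_def by auto
qed

text \<open>The half degree is defined by integer division, so the claim requires the degree of \<open>\<theta>\<close> to be even.
For homogeneous \<open>p\<close> of degree \<open>e\<close> all monomials of the sum of squares have degree \<open>2 (e - 1)\<close>, so
every monomial of \<open>\<theta>\<close> has even degree.\<close>

lemma theta_half_degree_bound:
  assumes "x_homogeneous e p"
  shows "Poly_Mapping.keys (theta p) \<subseteq> xz_exps (2 * theta_half_degree p)"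
proof -
  let ?f = "\<Sum>i\<in>UNIV. (x_partial i p)\<^sup>2"
  have part: "exps_abs \<beta> = e - 1" if \<beta>: "\<beta> \<in> Poly_Mapping.keys (x_partial i p)" for \<beta> i
  proof -
    obtain \<alpha> where "\<alpha> \<in> Poly_Mapping.keys p"
      "\<beta> \<in> Poly_Mapping.keys (Poly_Mapping.single (\<alpha> - axis i 1) (real (\<alpha> $ i) * Poly_Mapping.lookup p \<alpha>))"
      using \<beta> keys_sum unfolding x_partial_def by fastforce
    then have \<alpha>: "\<alpha> $ i \<noteq> 0" "\<beta> = \<alpha> - axis i 1" "exps_abs \<alpha> = e"
      using assms by (auto simp: x_homogeneous_def split: if_splits)
    then have "\<alpha> = axis i 1 + \<beta>" by (auto simp: vec_eq_iff axis_def)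
    then have "exps_abs \<alpha> = 1 + exps_abs \<beta>" by (metis exps_abs_add exps_abs_axis)
    then show ?thesis using \<alpha> by simp
  qed
  have f: "even (exps_abs \<beta>)" if \<beta>: "\<beta> \<in> Poly_Mapping.keys ?f" for \<beta>
  proof -
    obtain i where "\<beta> \<in> Poly_Mapping.keys ((x_partial i p)\<^sup>2)"
      using \<beta> keys_sum[of "\<lambda>i. (x_partial i p)\<^sup>2" UNIV] by blast
    then obtain \<beta>1 \<beta>2 where "\<beta> = \<beta>1 + \<beta>2" "\<beta>1 \<in> Poly_Mapping.keys (x_partial i p)"
      "\<beta>2 \<in> Poly_Mapping.keys (x_partial i p)"
      using keys_mult[of "x_partial i p" "x_partial i p"] unfolding power2_eq_square by blast
    then show ?thesis by (simp add: part)
  qed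
  have z: "(xz_z ^ 2 :: 'a xzpoly) = Poly_Mapping.single (0, 2) 1"
    by (simp add: xz_z_def power2_eq_square mult_single numeral_2_eq_2)
  have "even (case c of (\<alpha>, k) \<Rightarrow> exps_abs \<alpha> + k)" if c: "c \<in> Poly_Mapping.keys (theta p)" for c
  proof -
    have "c \<in> Poly_Mapping.keys (xz_z ^ 2 :: 'a xzpoly) \<union> Poly_Mapping.keys (xz_of_x ?f)"
      using c keys_diff[of "xz_z ^ 2 :: 'a xzpoly" "xz_of_x ?f"] unfolding theta_def by blast
    then consider "c = (0, 2)" | "c \<in> Poly_Mapping.keys (xz_of_x ?f)" by (auto simp: z)
    then show ?thesis
    proof cases
      case 2
      then obtain \<beta> where "\<beta> \<in> Poly_Mapping.keys ?f" "c = (\<beta>, 0)"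
        using keys_sum[of "\<lambda>\<beta>. Poly_Mapping.single (\<beta>, 0 :: nat) (Poly_Mapping.lookup ?f \<beta>)" "Poly_Mapping.keys ?f"]
        unfolding xz_of_x_def by (auto split: if_splits)
      then show ?thesis using f by simp
    qed auto
  qed
  moreover have "xz_degree (theta p) \<in> insert 0 ((\<lambda>(\<alpha>, k). exps_abs \<alpha> + k) ` Poly_Mapping.keys (theta p))"
    unfolding xz_degree_def by (intro Max_in) auto
  ultimately have "even (xz_degree (theta p))" by auto
  then show ?thesis
    unfolding theta_half_degree_def using keys_subset_xz_exps_degree by auto
qed

text \<open>Feasibility at order \<open>d\<close> depends only on the entries of degree at most \<open>2 d\<close>. The other entries
are unconstrained and have to be cut off before compactness can be used.\<close>

lemma Q_feasible_cong:
  fixes g :: "nat \<Rightarrow> 'n::finite xpoly"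
  assumes "x_homogeneous e (g j)" "1 \<le> d" "theta_half_degree (g j) \<le> d"
    and eq: "\<And>c. c \<in> xz_exps (2 * d) \<Longrightarrow> u c = w c"
    and u: "u \<in> Q_feasible m g b j \<tau> d"
  shows "w \<in> Q_feasible m g b j \<tau> d"
proof -
  let ?l = "theta_half_degree (g j)"
  have one: "Poly_Mapping.keys (1 :: 'n xzpoly) \<subseteq> xz_exps 0"
    by (auto simp: xz_exps_def zero_prod_def)
  have z: "Poly_Mapping.keys (xz_z :: 'n xzpoly) \<subseteq> xz_exps 1"
    by (simp add: xz_z_def xz_exps_def)
  have tz: "Poly_Mapping.keys (xz_const \<tau> - xz_z ^ 2 :: 'n xzpoly) \<subseteq> xz_exps 2"
  proof -
    have "(xz_z ^ 2 :: 'n xzpoly) = Poly_Mapping.single (0, 2) 1"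
      by (simp add: xz_z_def power2_eq_square mult_single numeral_2_eq_2)
    then show ?thesis
      using keys_diff[of "xz_const \<tau>" "xz_z ^ 2 :: 'n xzpoly"]
      by (auto simp: xz_const_def xz_exps_def split: if_splits)
  qed
  have "w (\<alpha>, 0) = phi_moment m g b j \<alpha>" if "exps_abs \<alpha> \<le> 2 * d" for \<alpha>
    using u eq[of "(\<alpha>, 0)"] that by (auto simp: Q_feasible_def xz_exps_def)
  moreover have "psd_on (xz_exps d) (local_matrix 1 w)"
    using u one by (intro psd_on_cong[OF local_matrix_cong[OF eq]]) (auto simp: Q_feasible_def)
  moreover have "zero_on (xz_exps (d - ?l)) (local_matrix (theta (g j)) w)"
    unfolding zero_on_def
  proof (intro ballI)
    fix a c :: "'n exps \<times> nat" assume ac: "a \<in> xz_exps (d - ?l)" "c \<in> xz_exps (d - ?l)"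
    have "local_matrix (theta (g j)) w a c = local_matrix (theta (g j)) u a c"
      using assms ac by (intro local_matrix_cong[symmetric, OF eq theta_half_degree_bound]) auto
    then show "local_matrix (theta (g j)) w a c = 0"
      using u ac by (simp add: Q_feasible_def zero_on_def)
  qed
  moreover have "psd_on (xz_exps (d - 1)) (local_matrix (xz_const \<tau> - xz_z ^ 2) w)"
    using u tz \<open>1 \<le> d\<close> by (intro psd_on_cong[OF local_matrix_cong[OF eq]]) (auto simp: Q_feasible_def)
  moreover have "psd_on (xz_exps (d - 1)) (local_matrix xz_z w)"
    using u z \<open>1 \<le> d\<close> by (intro psd_on_cong[OF local_matrix_cong[OF eq]]) (auto simp: Q_feasible_def)
  ultimately show ?thesis by (simp add: Q_feasible_def)
qed

text \<open>The diagonal entries of the localizing matrix of \<open>\<tau> - z\<^sup>2\<close> bound each even moment by \<open>\<tau>\<close> times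
the one with two fewer factors \<open>z\<close>. Since these moments are nonnegative, \<open>\<tau>\<close> may be replaced by
\<open>max \<tau> 0\<close>, which keeps the recursion monotone for either sign of \<open>\<tau>\<close>.\<close>

lemma Q_feasible_even_entry_bound:
  assumes u: "u \<in> Q_feasible m g b j \<tau> d" and "1 \<le> d"
  shows "exps_abs \<alpha> + k \<le> d \<Longrightarrow> 0 \<le> u (\<alpha> + \<alpha>, k + k) \<and>
    u (\<alpha> + \<alpha>, k + k) \<le> max \<tau> 0 ^ k * phi_moment m g b j (\<alpha> + \<alpha>)"
proof (induction k)
  case (Suc k)
  let ?a = "Poly_Mapping.single (\<alpha>, k) (1 :: real)"
  have "0 \<le> riesz u ((xz_const \<tau> - xz_z ^ 2) * (?a * ?a))"
    using u Suc.prems by (intro riesz_times_square_nonneg[of "d - 1"]) (auto simp: Q_feasible_def xz_exps_def)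
  also have "(xz_const \<tau> - xz_z ^ 2) * (?a * ?a) =
      Poly_Mapping.single (\<alpha> + \<alpha>, k + k) \<tau> - Poly_Mapping.single (\<alpha> + \<alpha>, Suc k + Suc k) 1"
    by (simp add: xz_const_def xz_z_def power2_eq_square mult_single left_diff_distrib)
  finally have "u (\<alpha> + \<alpha>, Suc k + Suc k) \<le> \<tau> * u (\<alpha> + \<alpha>, k + k)" by simp
  also have "\<dots> \<le> max \<tau> 0 * (max \<tau> 0 ^ k * phi_moment m g b j (\<alpha> + \<alpha>))"
    using Suc by (intro mult_mono) auto
  finally have "u (\<alpha> + \<alpha>, Suc k + Suc k) \<le> max \<tau> 0 ^ Suc k * phi_moment m g b j (\<alpha> + \<alpha>)"
    by (simp add: mult.assoc)
  moreover have "0 \<le> u (\<alpha> + \<alpha>, Suc k + Suc k)"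
    using riesz_times_square_nonneg[of d 1 u "Poly_Mapping.single (\<alpha>, Suc k) 1"] u Suc.prems
    by (auto simp: Q_feasible_def xz_exps_def mult_single)
  ultimately show ?case by blast
next
  case 0
  then have "u (\<alpha> + \<alpha>, 0) = phi_moment m g b j (\<alpha> + \<alpha>)"
    using u by (simp add: Q_feasible_def)
  moreover have "0 \<le> u (\<alpha> + \<alpha>, 0)"
    using riesz_times_square_nonneg[of d 1 u "Poly_Mapping.single (\<alpha>, 0) 1"] u 0
    by (auto simp: Q_feasible_def xz_exps_def mult_single)
  ultimately show ?case by simp
qed

text \<open>The entries on the diagonal of the moment matrix are bounded by the preceding lemma, and the
others by the Cauchy-Schwarz inequality.\<close>

lemma Q_feasible_entries_bounded:
  fixes g :: "nat \<Rightarrow> 'n::finite xpoly"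
  assumes "1 \<le> d"
  obtains B where "\<And>u c. u \<in> Q_feasible m g b j \<tau> d \<Longrightarrow> c \<in> xz_exps (2 * d) \<Longrightarrow> \<bar>u c\<bar> \<le> B"
proof
  let ?r = "\<lambda>(\<alpha>, k). \<bar>max \<tau> 0 ^ k * phi_moment m g b j (\<alpha> + \<alpha>)\<bar>"
  let ?B = "\<Sum>a\<in>xz_exps d. ?r a"
  fix u and c :: "'n exps \<times> nat"
  assume u: "u \<in> Q_feasible m g b j \<tau> d" and "c \<in> xz_exps (2 * d)"
  then obtain a b where ab: "a \<in> xz_exps d" "b \<in> xz_exps d" and c: "c = a + b"
    using xz_exps_decompose[of c d d] by (auto simp: mult_2)
  have diag: "0 \<le> u (a + a) \<and> u (a + a) \<le> ?B" if "a \<in> xz_exps d" for a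
  proof -
    obtain \<alpha> k where a: "a = (\<alpha>, k)" by (cases a)
    have "?r a \<le> ?B" using that by (intro member_le_sum finite_xz_exps) auto
    then show ?thesis
      using Q_feasible_even_entry_bound[OF u assms, of \<alpha> k] that by (auto simp: a xz_exps_def)
  qed
  have "(u (a + b))\<^sup>2 \<le> u (a + a) * u (b + b)"
    using riesz_cauchy_schwarz[of d u "Poly_Mapping.single a 1" "Poly_Mapping.single b 1"] u ab
    by (simp add: Q_feasible_def mult_single)
  also have "\<dots> \<le> ?B * ?B"
    using diag[OF ab(1)] diag[OF ab(2)] by (intro mult_mono; linarith)
  finally have "(u c)\<^sup>2 \<le> ?B\<^sup>2" unfolding c power2_eq_square .
  moreover have "0 \<le> ?B" using diag[OF ab(1)] by linarith
  ultimately show "\<bar>u c\<bar> \<le> ?B" by (simp only: abs_le_square_iff[symmetric] abs_of_nonneg)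
qed

lemma continuous_on_riesz: "continuous_on UNIV (\<lambda>u. riesz u p)"
  unfolding riesz_def by (intro continuous_intros continuous_on_product_coordinates)

lemma closed_Q_feasible: "closed (Q_feasible m g b j \<tau> d)"
  unfolding Q_feasible_def psd_on_def zero_on_def local_matrix_def Ball_def
  by (intro closed_Collect_conj closed_Collect_all closed_Collect_imp closed_Collect_eq closed_Collect_le
      open_Collect_const continuous_intros continuous_on_riesz continuous_on_product_coordinates)

text \<open>The constraints leave entries of high degree free; setting these to 0 gives a compact set with the
same objective values.\<close>

lemma Q_feasible_compact_representatives:
  fixes g :: "nat \<Rightarrow> 'n::finite xpoly"
  assumes "x_homogeneous e (g j)" "1 \<le> d" "theta_half_degree (g j) \<le> d"
  obtains C where "compact C" "C \<subseteq> Q_feasible m g b j \<tau> d"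
    "\<And>u. u \<in> Q_feasible m g b j \<tau> d \<Longrightarrow> \<exists>w\<in>C. Q_objective w = Q_objective u"
proof -
  let ?F = "Q_feasible m g b j \<tau> d"
  obtain B where B: "\<And>u c. u \<in> ?F \<Longrightarrow> c \<in> xz_exps (2 * d) \<Longrightarrow> \<bar>u c\<bar> \<le> B"
    using Q_feasible_entries_bounded[OF assms(2)] by blast
  define X :: "('n exps \<times> nat \<Rightarrow> real) set" where "X = PiE UNIV (\<lambda>c. if c \<in> xz_exps (2 * d) then {- B..B} else {0})"
  have "compactin (product_topology (\<lambda>_. euclidean) UNIV) X"
    unfolding X_def by (subst compactin_PiE) auto
  then have "compact X" by (simp add: euclidean_product_topology flip: compactin_euclidean_iff)
  show ?thesis
  proof
    show "compact (X \<inter> ?F)" using \<open>compact X\<close> closed_Q_feasible by (rule compact_Int_closed)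
    fix u assume u: "u \<in> ?F"
    let ?w = "\<lambda>c. if c \<in> xz_exps (2 * d) then u c else 0"
    have "?w \<in> ?F" using u by (intro Q_feasible_cong[of e g j d u ?w, OF assms]) auto
    moreover have "?w \<in> X" using B[OF u] by (auto simp: X_def abs_le_iff minus_le_iff)
    moreover have "Q_objective ?w = Q_objective u"
      using \<open>1 \<le> d\<close> by (simp add: Q_objective_def xz_exps_def)
    ultimately show "\<exists>w\<in>X \<inter> ?F. Q_objective w = Q_objective u" by blast
  qed auto
qed

lemma Q_optimal_exist:
  fixes g :: "nat \<Rightarrow> 'n::finite xpoly"
  assumes "x_homogeneous e (g j)" "1 \<le> d" "theta_half_degree (g j) \<le> d"
    and ne: "Q_feasible m g b j \<tau> d \<noteq> {}"
  shows "\<exists>u. Q_max_optimal m g b j \<tau> d u" "\<exists>w. Q_min_optimal m g b j \<tau> d w"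
proof -
  obtain C where C: "compact C" "C \<subseteq> Q_feasible m g b j \<tau> d"
    "\<And>u. u \<in> Q_feasible m g b j \<tau> d \<Longrightarrow> \<exists>w\<in>C. Q_objective w = Q_objective u"
    by (rule Q_feasible_compact_representatives[of e g j d m b \<tau>, OF assms(1-3)]) blast
  have "C \<noteq> {}" using ne C(3) by blast
  have cont: "continuous_on C Q_objective"
    unfolding Q_objective_def by (rule continuous_on_subset[OF continuous_on_product_coordinates]) auto
  obtain u where "u \<in> C" "\<And>w. w \<in> C \<Longrightarrow> Q_objective w \<le> Q_objective u"
    using continuous_attains_sup[OF C(1) \<open>C \<noteq> {}\<close> cont] by blast
  then have "Q_max_optimal m g b j \<tau> d u"
    unfolding Q_max_optimal_def is_arg_max_def using C(2,3) by (metis in_mono not_le)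
  then show "\<exists>u. Q_max_optimal m g b j \<tau> d u" by blast
  obtain w where "w \<in> C" "\<And>u. u \<in> C \<Longrightarrow> Q_objective w \<le> Q_objective u"
    using continuous_attains_inf[OF C(1) \<open>C \<noteq> {}\<close> cont] by blast
  then have "Q_min_optimal m g b j \<tau> d w"
    unfolding Q_min_optimal_def is_arg_min_def using C(2,3) by (metis in_mono not_le)
  then show "\<exists>w. Q_min_optimal m g b j \<tau> d w" by blast
qed


section \<open>Integration over a face\<close>

lemma set_integrable_continuous_compact:
  fixes f :: "'a::metric_space \<Rightarrow> real"
  assumes "finite_measure N" "sets N = sets borel" "compact K" "continuous_on K f"
  shows "set_integrable N K f"
proof -
  interpret finite_measure N by fact
  have "bounded (f ` K)" using assms by (intro compact_imp_bounded compact_continuous_image)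
  then obtain B where B: "\<And>x. x \<in> K \<Longrightarrow> norm (f x) \<le> B" by (auto simp: bounded_iff)
  have "norm (indicator K x *\<^sub>R f x) \<le> max B 0" for x
    using B[of x] by (auto split: split_indicator)
  moreover have "(\<lambda>x. indicator K x *\<^sub>R f x) \<in> borel_measurable N"
    unfolding measurable_cong_sets[OF assms(2) refl]
    using assms by (intro borel_measurable_continuous_on_indicator borel_compact)
  ultimately show ?thesis
    unfolding set_integrable_def by (intro integrable_const_bound[where B = "max B 0"]) auto
qed

text \<open>The fourth power is uniformly continuous on bounded intervals, so it suffices to approximate \<open>r\<close>.\<close>

lemma fourth_power_dense:
  fixes r :: "real ^ 'n \<Rightarrow> real"
  assumes "compact K" "continuous_on K r" "\<delta> > 0"
  shows "\<exists>s. \<forall>x\<in>K. \<bar>r x ^ 4 - x_eval s x ^ 4\<bar> < \<delta>"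
proof -
  have "bounded (r ` K)" using assms by (intro compact_imp_bounded compact_continuous_image)
  then obtain R where R: "\<And>x. x \<in> K \<Longrightarrow> \<bar>r x\<bar> \<le> R" by (auto simp: bounded_iff)
  have "uniformly_continuous_on {- (R + 1)..R + 1} (\<lambda>t::real. t ^ 4)"
    by (intro compact_uniformly_continuous continuous_intros compact_Icc)
  then obtain \<eta> where \<eta>: "\<eta> > 0"
    "\<And>s t. s \<in> {- (R + 1)..R + 1} \<Longrightarrow> t \<in> {- (R + 1)..R + 1} \<Longrightarrow> dist s t < \<eta> \<Longrightarrow> dist (s ^ 4) (t ^ 4) < \<delta>"
    using \<open>\<delta> > 0\<close> unfolding uniformly_continuous_on_def by metis
  obtain s where s: "\<And>x. x \<in> K \<Longrightarrow> \<bar>r x - x_eval s x\<bar> < min \<eta> 1"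
    using x_eval_uniformly_dense[OF assms(1,2), of "min \<eta> 1"] \<eta>(1) by auto
  have "\<bar>r x ^ 4 - x_eval s x ^ 4\<bar> < \<delta>" if "x \<in> K" for x
  proof -
    have "r x \<in> {- (R + 1)..R + 1}" "x_eval s x \<in> {- (R + 1)..R + 1}"
      using R[OF that] s[OF that] unfolding atLeastAtMost_iff by linarith+
    then show ?thesis using \<eta>(2)[of "r x" "x_eval s x"] s[OF that] by (simp add: dist_real_def)
  qed
  then show ?thesis by blast
qed

lemma sets_sigma_bd [simp]: "sets (sigma_bd m g b) = sets borel"
  by (simp add: sigma_bd_def)

lemma sets_sigma_face [simp]: "sets (sigma_face m g b j) = sets borel"
  by (simp add: sigma_face_def)

lemma space_sigma_face [simp]: "space (sigma_face m g b j) = UNIV"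
  by (simp add: sigma_face_def sigma_bd_def)

lemma compact_Omega_face:
  assumes "compact (Omega m g b)"
  shows "compact (Omega_face m g b j)"
proof -
  have "Omega_face m g b j = Omega m g b \<inter> {x. x_eval (g j) x = b j}"
    by (auto simp: Omega_face_def)
  moreover have "closed {x. x_eval (g j) x = b j}"
    by (intro closed_Collect_eq continuous_intros)
  ultimately show ?thesis using assms by (simp add: compact_Int_closed)
qed

lemma emeasure_sigma_face:
  assumes "compact (Omega m g b)" "A \<in> sets borel"
  shows "emeasure (sigma_face m g b j) A = emeasure (sigma_bd m g b) (Omega_face m g b j \<inter> A)"
  unfolding sigma_face_def
  using assms by (intro emeasure_restricted) (auto intro!: borel_compact compact_Omega_face)

text \<open>Without finiteness the total mass could not be read off from the moments, since the integral of a
function that is not integrable is 0 by convention.\<close>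

lemma finite_measure_sigma_face:
  fixes g :: "nat \<Rightarrow> 'n::finite xpoly"
  assumes "compact (Omega m g b)" and grad: "\<And>x. x \<in> Omega_face m g b j \<Longrightarrow> x_grad (g j) x \<noteq> 0"
  shows "finite_measure (sigma_face m g b j)"
proof
  let ?K = "Omega_face m g b j" and ?H = "hausdorff_measure (CARD('n) - 1) :: (real ^ 'n) measure"
  have K: "compact ?K" using assms by (intro compact_Omega_face)
  have "emeasure (sigma_face m g b j) (space (sigma_face m g b j)) = emeasure (sigma_bd m g b) ?K"
    using assms by (simp add: emeasure_sigma_face)
  also have "\<dots> = emeasure ?H (frontier (Omega m g b) \<inter> ?K)"
    unfolding sigma_bd_def using K by (intro emeasure_restricted) (auto intro: borel_compact)
  also have "\<dots> \<le> emeasure ?H ?K"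
    using K by (intro emeasure_mono) (auto intro: borel_compact)
  also have "\<dots> = hausdorff_outer (CARD('n) - 1) ?K"
    using K by (intro emeasure_hausdorff_measure borel_compact)
  also have "\<dots> < \<infinity>"
    using K grad by (intro hausdorff_outer_regular_level_set_finite[where p = "g j" and c = "b j"])
      (auto simp: Omega_face_def)
  finally show "emeasure (sigma_face m g b j) (space (sigma_face m g b j)) \<noteq> \<infinity>" by simp
qed

lemma set_integral_phi_face:
  assumes "compact (Omega m g b)" "continuous_on (Omega_face m g b j) f"
  shows "(LINT x:Omega_face m g b j|phi_face m g b j. f x) =
    (LINT x:Omega_face m g b j|sigma_face m g b j. f x / norm (x_grad (g j) x))"
proof -
  let ?K = "Omega_face m g b j" and ?N = "sigma_face m g b j"
  have meas: "(\<lambda>x. indicator ?K x *\<^sub>R f x) \<in> borel_measurable ?N"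
    unfolding measurable_cong_sets[OF sets_sigma_face refl]
    using assms compact_Omega_face by (intro borel_measurable_continuous_on_indicator borel_compact) auto
  have "(\<lambda>x. norm (x_grad (g j) x)) \<in> borel_measurable borel"
    by (intro borel_measurable_continuous_onI continuous_intros)
  then have h: "(\<lambda>x. 1 / norm (x_grad (g j) x)) \<in> borel_measurable ?N"
    unfolding measurable_cong_sets[OF sets_sigma_face refl] by measurable
  show ?thesis
    unfolding set_lebesgue_integral_def phi_face_def
    by (subst integral_density[OF meas h]) (auto intro!: Bochner_Integration.integral_cong)
qed

text \<open>The gradient does not vanish on the compact face, so \<open>1 / \<parallel>\<nabla>g\<^sub>j\<parallel>\<close> is bounded there and all
polynomials are integrable.\<close>

lemma lin_ext_phi_moment:
  fixes g :: "nat \<Rightarrow> 'n::finite xpoly"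
  assumes cpt: "compact (Omega m g b)" and grad: "\<And>x. x \<in> Omega_face m g b j \<Longrightarrow> x_grad (g j) x \<noteq> 0"
  shows "lin_ext (phi_moment m g b j) p =
    (LINT x:Omega_face m g b j|sigma_face m g b j. x_eval p x / norm (x_grad (g j) x))"
proof -
  let ?K = "Omega_face m g b j" and ?N = "sigma_face m g b j"
  have int: "set_integrable ?N ?K (\<lambda>x. x_eval p x / norm (x_grad (g j) x))" for p
    using grad by (intro set_integrable_continuous_compact finite_measure_sigma_face[OF cpt]
        compact_Omega_face[OF cpt] continuous_intros) auto
  show ?thesis
  proof (induction p rule: poly_mapping_additive_induct)
    case (single \<alpha> c)
    show ?case
      by (simp add: phi_moment_def set_integral_phi_face[OF cpt continuous_on_x_monom] flip: set_integral_mult_right)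
  next
    case (add p q)
    then show ?case by (simp add: lin_ext_add add_divide_distrib set_integral_add int)
  qed simp
qed

section \<open>Convergence of the programs\<close>

lemma eventually_exps_abs_bound: "eventually (\<lambda>d. \<forall>\<alpha>\<in>Poly_Mapping.keys p. exps_abs \<alpha> \<le> 2 * d) sequentially"
proof -
  have "exps_abs \<alpha> \<le> 2 * d" if "\<alpha> \<in> Poly_Mapping.keys p" "d \<ge> (\<Sum>\<alpha>\<in>Poly_Mapping.keys p. exps_abs \<alpha>)" for \<alpha> d
    using member_le_sum[of \<alpha> "Poly_Mapping.keys p" exps_abs] that by simp
  then show ?thesis unfolding eventually_sequentially by blast
qed

text \<open>The uniform form of the convergence: for large \<open>d\<close>, every feasible point has its entry
\<open>(\<alpha>, 1)\<close> near the integral, whether it is optimal or not. The error \<open>\<epsilon> C\<close> is the sum of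
\<open>\<epsilon> \<surd>(V M)\<close>, for replacing \<open>z\<close> by \<open>s\<^sup>2\<close> under the Riesz functional, and of \<open>\<epsilon> A\<close>, for
replacing \<open>s\<^sup>2\<close> by \<open>h\<close> under the integral.\<close>

lemma feasible_first_moments_converge:
  fixes g :: "nat \<Rightarrow> 'n::finite xpoly"
  assumes cpt: "compact (Omega m g b)" and grad: "\<And>x. x \<in> Omega_face m g b j \<Longrightarrow> x_grad (g j) x \<noteq> 0"
    and "e > 0"
  shows "\<forall>\<^sub>F d in sequentially. \<forall>u\<in>Q_feasible m g b j \<tau> d.
    \<bar>u (\<alpha>, 1) - (LINT x:Omega_face m g b j|sigma_face m g b j. x_monom \<alpha> x)\<bar> < e"
proof -
  let ?K = "Omega_face m g b j" and ?N = "sigma_face m g b j"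
  define h where "h x = norm (x_grad (g j) x)" for x
  \<comment> \<open>\<open>J\<close> is integration against \<open>\<phi>\<^sub>j\<close>, written as an integral against \<open>\<sigma>\<^sub>j\<close>.\<close>
  define J where "J F = (LINT x:?K|?N. F x / h x)" for F
  define f where "f = (\<Sum>i\<in>UNIV. (x_partial i (g j))\<^sup>2)"
  define q :: "'n xpoly" where "q = Poly_Mapping.single \<alpha> 1"
  have K: "compact ?K" by (rule compact_Omega_face[OF cpt])
  have h: "h x > 0" if "x \<in> ?K" for x using grad[OF that] by (simp add: h_def)
  have hc: "continuous_on A h" for A
    unfolding h_def by (intro continuous_intros)
  have f: "x_eval f x = (h x)\<^sup>2" for x
    unfolding h_def power2_norm_eq_inner by (simp add: f_def x_grad_def inner_vec_def power2_eq_square)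
  have int: "set_integrable ?N ?K (\<lambda>x. F x / h x)" if "continuous_on ?K F" for F
    using h that K by (intro set_integrable_continuous_compact finite_measure_sigma_face[OF cpt grad]
        continuous_on_divide hc) (auto dest: h)
  have J_mono: "J F \<le> J G"
    if "continuous_on ?K F" "continuous_on ?K G" "\<And>x. x \<in> ?K \<Longrightarrow> F x \<le> G x" for F G
    unfolding J_def using that h by (intro set_integral_mono int divide_right_mono) (auto intro: less_imp_le)
  have J_mult: "J (\<lambda>x. c * F x) = c * J F" for c F
    by (simp add: J_def flip: set_integral_mult_right)
  have J_diff: "J (\<lambda>x. F x - G x) = J F - J G" if "continuous_on ?K F" "continuous_on ?K G" for F G
    using that by (simp add: J_def diff_divide_distrib set_integral_diff int)
  have J_nonneg: "0 \<le> J F" if "continuous_on ?K F" "\<And>x. x \<in> ?K \<Longrightarrow> 0 \<le> F x" for F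
    using J_mono[of "\<lambda>_. 0" F] that by (simp add: J_def)
  define V where "V = J (\<lambda>x. (x_monom \<alpha> x)\<^sup>2)"
  define M where "M = J (\<lambda>_. 1)"
  define A where "A = J (\<lambda>x. \<bar>x_monom \<alpha> x\<bar>)"
  have nonneg: "0 \<le> V" "0 \<le> M" "0 \<le> A"
    unfolding V_def M_def A_def by (auto intro!: J_nonneg continuous_intros)
  define C where "C = sqrt (V * M) + A"
  have C: "0 \<le> C" using nonneg by (simp add: C_def)
  \<comment> \<open>The added 1 covers \<open>C = 0\<close> and makes the final inequality strict.\<close>
  define \<epsilon> where "\<epsilon> = e / (C + 1)"
  have \<epsilon>: "\<epsilon> > 0" "\<epsilon> * C < e"
    using C \<open>e > 0\<close> by (auto simp: \<epsilon>_def field_simps)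
  have "continuous_on ?K (\<lambda>x. sqrt (h x))" by (intro continuous_intros hc)
  then obtain s where "\<And>x. x \<in> ?K \<Longrightarrow> \<bar>sqrt (h x) ^ 4 - x_eval s x ^ 4\<bar> < \<epsilon>\<^sup>2"
    using fourth_power_dense[OF K, of "\<lambda>x. sqrt (h x)" "\<epsilon>\<^sup>2"] \<epsilon>(1) by auto
  moreover have "sqrt (h x) ^ 4 = (h x)\<^sup>2" for x
    using power_mult[of "sqrt (h x)" 2 2] by (simp add: h_def)
  ultimately have s: "\<bar>(h x)\<^sup>2 - x_eval s x ^ 4\<bar> \<le> \<epsilon>\<^sup>2" if "x \<in> ?K" for x
    using that by (metis less_imp_le)
  \<comment> \<open>Since \<open>s\<^sup>2\<close> and \<open>h\<close> are nonnegative, \<open>\<bar>s\<^sup>2 - h\<bar> \<le> \<bar>s\<^sup>2 + h\<bar>\<close>, and hence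
    \<open>\<bar>s\<^sup>2 - h\<bar>\<^sup>2 \<le> \<bar>s\<^sup>4 - h\<^sup>2\<bar>\<close>: closeness of the squares gives closeness of the roots.\<close>
  have root: "\<bar>(x_eval s x)\<^sup>2 - h x\<bar> \<le> \<epsilon>" if "x \<in> ?K" for x
  proof -
    let ?t = "(x_eval s x)\<^sup>2"
    have "\<bar>?t - h x\<bar>\<^sup>2 \<le> \<bar>?t - h x\<bar> * \<bar>?t + h x\<bar>"
      unfolding power2_eq_square using h[OF that] by (intro mult_left_mono) (auto simp: abs_le_iff)
    also have "\<dots> = \<bar>(h x)\<^sup>2 - x_eval s x ^ 4\<bar>"
      by (subst abs_minus_commute) (simp add: abs_mult[symmetric] algebra_simps power2_eq_square power4_eq_xxxx)
    also have "\<dots> \<le> \<epsilon>\<^sup>2" by (rule s[OF that])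
    finally show ?thesis using \<epsilon>(1) by (simp add: abs_le_square_iff[symmetric])
  qed
  have near: "\<bar>J (\<lambda>x. x_monom \<alpha> x * (x_eval s x)\<^sup>2) - (LINT x:?K|?N. x_monom \<alpha> x)\<bar> \<le> \<epsilon> * A"
  proof -
    let ?D = "\<lambda>x. x_monom \<alpha> x * (x_eval s x)\<^sup>2 - x_monom \<alpha> x * h x"
    have "(LINT x:?K|?N. x_monom \<alpha> x) = J (\<lambda>x. x_monom \<alpha> x * h x)"
      unfolding J_def using h K by (intro set_lebesgue_integral_cong) (auto intro: borel_compact dest: h)
    then have eq: "J (\<lambda>x. x_monom \<alpha> x * (x_eval s x)\<^sup>2) - (LINT x:?K|?N. x_monom \<alpha> x) = J ?D"
      by (simp add: J_diff continuous_intros hc)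
    have D: "\<bar>?D x\<bar> \<le> \<epsilon> * \<bar>x_monom \<alpha> x\<bar>" if "x \<in> ?K" for x
      using mult_right_mono[OF root[OF that], of "\<bar>x_monom \<alpha> x\<bar>"]
      by (simp add: abs_mult[symmetric] algebra_simps)
    have "J ?D \<le> J (\<lambda>x. \<epsilon> * \<bar>x_monom \<alpha> x\<bar>)" "J (\<lambda>x. - \<epsilon> * \<bar>x_monom \<alpha> x\<bar>) \<le> J ?D"
      using D by (intro J_mono continuous_intros hc; fastforce simp: abs_le_iff)+
    then show ?thesis unfolding eq J_mult by (simp add: A_def abs_le_iff)
  qed
  define Q S where "Q = xz_of_x q" and "S = xz_of_x s"
  define W where "W = xz_z - S * S"
  have theta: "theta (g j) = xz_z ^ 2 - xz_of_x f"
    by (simp add: theta_def f_def)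
  let ?l = "theta_half_degree (g j)"
  \<comment> \<open>The conditions on the order \<open>d\<close>: it has to exceed the degrees of the finitely many polynomials
    to which the constraints are applied. Some bounds read \<open>d - 0\<close> so that they all have the form
    covered by \<open>eventually_keys_subset_xz_exps\<close>.\<close>
  let ?E = "\<lambda>d. Poly_Mapping.keys Q \<subseteq> xz_exps (d - 0) \<and> Poly_Mapping.keys W \<subseteq> xz_exps (d - 0) \<and>
    Poly_Mapping.keys (1 :: 'n xzpoly) \<subseteq> xz_exps (d - 0) \<and> Poly_Mapping.keys (W * W) \<subseteq> xz_exps (d - 0) \<and>
    Poly_Mapping.keys (S * W) \<subseteq> xz_exps (d - 1) \<and>
    Poly_Mapping.keys (xz_z ^ 2 - xz_of_x f + 2 * (xz_of_x f - S ^ 4)) \<subseteq> xz_exps (d - ?l) \<and>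
    (\<forall>p\<in>{q * q, 1, (f - s ^ 4)\<^sup>2, q * (s * s)}. \<forall>\<alpha>\<in>Poly_Mapping.keys p. exps_abs \<alpha> \<le> 2 * d)"
  have "eventually ?E sequentially"
    by (intro eventually_conj eventually_keys_subset_xz_exps eventually_ball_finite ballI
        eventually_exps_abs_bound) simp
  then show ?thesis
  proof (eventually_elim, intro ballI)
    fix d u assume E: "?E d" and u: "u \<in> Q_feasible m g b j \<tau> d"
    have mom: "riesz u (xz_of_x p) = J (x_eval p)" if "\<forall>\<alpha>\<in>Poly_Mapping.keys p. exps_abs \<alpha> \<le> 2 * d" for p
    proof -
      have "riesz u (xz_of_x p) = lin_ext (phi_moment m g b j) p"
        using u that by (simp add: riesz_xz_of_x lin_ext_def Q_feasible_def)
      then show ?thesis by (simp add: lin_ext_phi_moment[OF cpt grad] J_def h_def)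
    qed
    have "riesz u (Q * Q) = J (x_eval (q * q))" using E mom[of "q * q"] by (simp add: Q_def)
    also have "x_eval (q * q) = (\<lambda>x. (x_monom \<alpha> x)\<^sup>2)" by (simp add: fun_eq_iff q_def power2_eq_square)
    finally have V: "riesz u (Q * Q) = V" by (simp only: V_def)
    have "x_eval 1 = (\<lambda>x :: real ^ 'n. 1)" by (simp add: fun_eq_iff)
    then have M: "riesz u 1 = M" using E mom[of 1] by (simp add: M_def)
    have "riesz u ((xz_of_x f - S ^ 4)\<^sup>2) = J (x_eval ((f - s ^ 4)\<^sup>2))"
      using E mom[of "(f - s ^ 4)\<^sup>2"] by (simp add: S_def)
    also have "\<dots> \<le> J (\<lambda>x. (\<epsilon>\<^sup>2)\<^sup>2 * 1)"
    proof (intro J_mono continuous_intros)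
      fix x assume "x \<in> ?K"
      from power_mono[OF s[OF this], of 2] show "x_eval ((f - s ^ 4)\<^sup>2) x \<le> (\<epsilon>\<^sup>2)\<^sup>2 * 1" by (simp add: f)
    qed
    also have "\<dots> = (\<epsilon>\<^sup>2)\<^sup>2 * M" by (simp only: J_mult M_def)
    finally have err: "riesz u ((xz_of_x f - S ^ 4)\<^sup>2) \<le> (\<epsilon>\<^sup>2)\<^sup>2 * M" .
    have "(riesz u (Q * W)) ^ 4 \<le> (riesz u (Q * Q))\<^sup>2 * (riesz u 1 * riesz u ((xz_of_x f - S ^ 4)\<^sup>2))"
      unfolding W_def
      by (rule riesz_root_estimate[where d = d and k = "d - 1" and l = "d - ?l"])
         (use u E in \<open>auto simp: Q_feasible_def theta W_def[symmetric]\<close>)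
    also have "\<dots> \<le> V\<^sup>2 * (M * ((\<epsilon>\<^sup>2)\<^sup>2 * M))"
      unfolding V M using nonneg err by (intro mult_left_mono) auto
    also have "\<dots> = (\<epsilon> * sqrt (V * M)) ^ 4"
    proof -
      have "sqrt (V * M) ^ 4 = V\<^sup>2 * M\<^sup>2"
        using nonneg power_mult[of "sqrt (V * M)" 2 2] by (simp add: power_mult_distrib)
      then have eq: "(\<epsilon> * sqrt (V * M)) ^ 4 = \<epsilon> ^ 4 * (V\<^sup>2 * M\<^sup>2)" by (simp only: power_mult_distrib)
      show ?thesis unfolding eq by (simp add: power2_eq_square power4_eq_xxxx)
    qed
    finally have "\<bar>riesz u (Q * W)\<bar> ^ 4 \<le> (\<epsilon> * sqrt (V * M)) ^ 4" by (simp add: power_abs)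
    then have QW: "\<bar>riesz u (Q * W)\<bar> \<le> \<epsilon> * sqrt (V * M)"
      using power_mono_iff[of "\<bar>riesz u (Q * W)\<bar>" "\<epsilon> * sqrt (V * M)" 4] \<epsilon>(1) nonneg by simp
    have "Q * W = Poly_Mapping.single (\<alpha>, 1) 1 - xz_of_x (q * (s * s))"
      by (simp add: Q_def W_def S_def q_def xz_z_def right_diff_distrib mult_single)
    then have "riesz u (Q * W) = u (\<alpha>, 1) - J (x_eval (q * (s * s)))"
      using E mom[of "q * (s * s)"] by (simp del: xz_of_x_mult)
    also have "x_eval (q * (s * s)) = (\<lambda>x. x_monom \<alpha> x * (x_eval s x)\<^sup>2)"
      by (simp add: fun_eq_iff q_def power2_eq_square)
    finally have "\<bar>u (\<alpha>, 1) - (LINT x:?K|?N. x_monom \<alpha> x)\<bar> \<le> \<epsilon> * sqrt (V * M) + \<epsilon> * A"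
      using QW near by linarith
    also have "\<dots> = \<epsilon> * C" by (simp add: C_def algebra_simps)
    finally show "\<bar>u (\<alpha>, 1) - (LINT x:?K|?N. x_monom \<alpha> x)\<bar> < e" using \<epsilon>(2) by simp
  qed
qed

lemma d2_min_ge:
  assumes "d2_min m g dg j \<le> d"
  shows "1 \<le> d" "theta_half_degree (g j) \<le> d"
proof -
  have "x \<le> d2_min m g dg j" if "x \<in> {1, theta_half_degree (g j)}" for x
    unfolding d2_min_def using that by (intro Max_ge) auto
  from this[of 1] this[of "theta_half_degree (g j)"] assms
  show "1 \<le> d" "theta_half_degree (g j) \<le> d" by auto
qed

lemma Q_max_value_eq:
  assumes "Q_max_optimal m g b j \<tau> d u"
  shows "Q_max_value m g b j \<tau> d = ereal (u (0, 1))"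
  using assms unfolding Q_max_value_def Q_max_optimal_def is_arg_max_def
  by (intro antisym SUP_least SUP_upper2[of u]) (auto simp: Q_objective_def not_less)

lemma Q_min_value_eq:
  assumes "Q_min_optimal m g b j \<tau> d w"
  shows "Q_min_value m g b j \<tau> d = ereal (w (0, 1))"
  using assms unfolding Q_min_value_def Q_min_optimal_def is_arg_min_def
  by (intro antisym INF_greatest INF_lower2[of w]) (auto simp: Q_objective_def not_less)

lemma feasible_sequence_first_moments_tendsto:
  fixes g :: "nat \<Rightarrow> 'n::finite xpoly"
  assumes "compact (Omega m g b)" "\<And>x. x \<in> Omega_face m g b j \<Longrightarrow> x_grad (g j) x \<noteq> 0"
    and "\<And>d. d \<ge> d0 \<Longrightarrow> u d \<in> Q_feasible m g b j \<tau> d"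
  shows "(\<lambda>d. u d (\<alpha>, 1)) \<longlonglongrightarrow> (LINT x:Omega_face m g b j|sigma_face m g b j. x_monom \<alpha> x)"
proof (rule tendstoI)
  fix e :: real assume "e > 0"
  have "\<forall>\<^sub>F d in sequentially. \<forall>u\<in>Q_feasible m g b j \<tau> d.
      \<bar>u (\<alpha>, 1) - (LINT x:Omega_face m g b j|sigma_face m g b j. x_monom \<alpha> x)\<bar> < e"
    using assms(1,2) \<open>e > 0\<close> by (rule feasible_first_moments_converge)
  then show "\<forall>\<^sub>F d in sequentially. dist (u d (\<alpha>, 1))
      (LINT x:Omega_face m g b j|sigma_face m g b j. x_monom \<alpha> x) < e"
    using eventually_ge_at_top[of d0]
    by eventually_elim (use assms(3) in \<open>auto simp: dist_real_def\<close>)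
qed

text \<open>The total mass of \<open>\<sigma>\<^sub>j\<close> is finite, so it is the integral of the constant monomial, which is the
limit for \<open>\<alpha> = 0\<close>.\<close>

lemma emeasure_sigma_face_Omega:
  fixes g :: "nat \<Rightarrow> 'n::finite xpoly"
  assumes cpt: "compact (Omega m g b)" and grad: "\<And>x. x \<in> Omega_face m g b j \<Longrightarrow> x_grad (g j) x \<noteq> 0"
  shows "enn2ereal (emeasure (sigma_face m g b j) (Omega m g b)) =
    ereal (LINT x:Omega_face m g b j|sigma_face m g b j. x_monom 0 x)"
proof -
  interpret finite_measure "sigma_face m g b j" by (rule finite_measure_sigma_face[OF assms])
  let ?K = "Omega_face m g b j"
  have K: "?K \<in> sets borel" "Omega m g b \<in> sets borel"
    using cpt by (auto intro: borel_compact compact_Omega_face)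
  have "?K \<inter> Omega m g b = ?K" by (auto simp: Omega_face_def)
  then have "emeasure (sigma_face m g b j) (Omega m g b) = emeasure (sigma_face m g b j) ?K"
    using K by (simp add: emeasure_sigma_face[OF cpt])
  then show ?thesis using K by (simp add: emeasure_eq_measure set_lebesgue_integral_def)
qed

theorem theorem3p6:
  fixes g :: "nat \<Rightarrow> 'n::finite xpoly" and b :: "nat \<Rightarrow> real" and dg :: "nat \<Rightarrow> nat"
    and m j :: nat and \<tau> :: real
  assumes hom: "\<And>k. k \<in> {1..m} \<Longrightarrow> x_homogeneous (dg k) (g k)"
    and cpt: "compact (Omega m g b)"
    and cube: "Omega m g b \<subseteq> {x. \<forall>i. -1 < x $ i \<and> x $ i < 1}"
    and grad: "\<And>k x. k \<in> {1..m} \<Longrightarrow> x \<in> Omega_face m g b k \<Longrightarrow> x_grad (g k) x \<noteq> 0"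
    and null: "\<And>k l. k \<in> {1..m} \<Longrightarrow> l \<in> {1..m} \<Longrightarrow> l \<noteq> k \<Longrightarrow>
                 emeasure (sigma_face m g b k) {x. x_eval (g l) x = b l} = 0"
    and j: "j \<in> {1..m}"
    and tau: "ereal \<tau> > (SUP x\<in>Omega_face m g b j. ereal ((norm (x_grad (g j) x))\<^sup>2))"
    and feas: "\<And>d. d \<ge> d2_min m g dg j \<Longrightarrow> Q_feasible m g b j \<tau> d \<noteq> {}"
  shows "(\<forall>d\<ge>d2_min m g dg j. (\<exists>u. Q_max_optimal m g b j \<tau> d u) \<and> (\<exists>w. Q_min_optimal m g b j \<tau> d w)) \<and>
    (\<forall>u. (\<forall>d\<ge>d2_min m g dg j. Q_max_optimal m g b j \<tau> d (u d)) \<longrightarrow>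
       (\<forall>\<alpha>. (\<lambda>d. u d (\<alpha>, 1)) \<longlonglongrightarrow>
               (LINT x:Omega_face m g b j|sigma_face m g b j. x_monom \<alpha> x)) \<and>
       (\<forall>d\<ge>d2_min m g dg j. Q_max_value m g b j \<tau> d = ereal (u d (0, 1)))) \<and>
    (\<forall>w. (\<forall>d\<ge>d2_min m g dg j. Q_min_optimal m g b j \<tau> d (w d)) \<longrightarrow>
       (\<forall>\<alpha>. (\<lambda>d. w d (\<alpha>, 1)) \<longlonglongrightarrow>
               (LINT x:Omega_face m g b j|sigma_face m g b j. x_monom \<alpha> x)) \<and>
       (\<forall>d\<ge>d2_min m g dg j. Q_min_value m g b j \<tau> d = ereal (w d (0, 1)))) \<and>
    (\<forall>d e. d2_min m g dg j \<le> d \<and> d \<le> e \<longrightarrow> Q_max_value m g b j \<tau> e \<le> Q_max_value m g b j \<tau> d) \<and>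
    Q_max_value m g b j \<tau> \<longlonglongrightarrow> enn2ereal (emeasure (sigma_face m g b j) (Omega m g b)) \<and>
    (\<forall>d e. d2_min m g dg j \<le> d \<and> d \<le> e \<longrightarrow> Q_min_value m g b j \<tau> d \<le> Q_min_value m g b j \<tau> e) \<and>
    Q_min_value m g b j \<tau> \<longlonglongrightarrow> enn2ereal (emeasure (sigma_face m g b j) (Omega m g b))"
proof -
  let ?F = "Q_feasible m g b j \<tau>" and ?d0 = "d2_min m g dg j"
  let ?I = "\<lambda>\<alpha>. LINT x:Omega_face m g b j|sigma_face m g b j. x_monom \<alpha> x"
  have grad_j: "\<And>x. x \<in> Omega_face m g b j \<Longrightarrow> x_grad (g j) x \<noteq> 0" using grad j by blast
  note lim = feasible_sequence_first_moments_tendsto[OF cpt grad_j, where ?d0.0 = ?d0 and \<tau> = \<tau>]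
  have max_feas: "u \<in> ?F d" if "Q_max_optimal m g b j \<tau> d u" for d u
    using that by (simp add: Q_max_optimal_def is_arg_max_def)
  have min_feas: "w \<in> ?F d" if "Q_min_optimal m g b j \<tau> d w" for d w
    using that by (simp add: Q_min_optimal_def is_arg_min_def)
  have ex: "\<exists>u. Q_max_optimal m g b j \<tau> d u" "\<exists>w. Q_min_optimal m g b j \<tau> d w" if "?d0 \<le> d" for d
    using Q_optimal_exist[OF hom[OF j] d2_min_ge[OF that] feas[OF that]] by blast+
  obtain u where u: "\<And>d. ?d0 \<le> d \<Longrightarrow> Q_max_optimal m g b j \<tau> d (u d)" using ex(1) by metis
  obtain w where w: "\<And>d. ?d0 \<le> d \<Longrightarrow> Q_min_optimal m g b j \<tau> d (w d)" using ex(2) by metis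
  have sigma: "enn2ereal (emeasure (sigma_face m g b j) (Omega m g b)) = ereal (?I 0)"
    by (rule emeasure_sigma_face_Omega[OF cpt grad_j])
  have "(\<lambda>d. ereal (u d (0, 1))) \<longlonglongrightarrow> ereal (?I 0)"
    using lim[of u 0] max_feas u by (intro tendsto_ereal) auto
  moreover have "\<forall>\<^sub>F d in sequentially. ereal (u d (0, 1)) = Q_max_value m g b j \<tau> d"
    using eventually_ge_at_top[of ?d0] by eventually_elim (simp add: Q_max_value_eq[OF u])
  ultimately have max_lim: "Q_max_value m g b j \<tau> \<longlonglongrightarrow> ereal (?I 0)"
    by (rule Lim_transform_eventually)
  have "(\<lambda>d. ereal (w d (0, 1))) \<longlonglongrightarrow> ereal (?I 0)"
    using lim[of w 0] min_feas w by (intro tendsto_ereal) auto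
  moreover have "\<forall>\<^sub>F d in sequentially. ereal (w d (0, 1)) = Q_min_value m g b j \<tau> d"
    using eventually_ge_at_top[of ?d0] by eventually_elim (simp add: Q_min_value_eq[OF w])
  ultimately have min_lim: "Q_min_value m g b j \<tau> \<longlonglongrightarrow> ereal (?I 0)"
    by (rule Lim_transform_eventually)
  have values_mono: "Q_max_value m g b j \<tau> e \<le> Q_max_value m g b j \<tau> d"
    "Q_min_value m g b j \<tau> d \<le> Q_min_value m g b j \<tau> e" if "d \<le> e" for d e
    unfolding Q_max_value_def Q_min_value_def
    using Q_feasible_antimono[OF that] by (intro SUP_subset_mono INF_superset_mono order_refl; blast)+
  have "\<forall>d\<ge>?d0. (\<exists>u. Q_max_optimal m g b j \<tau> d u) \<and> (\<exists>w. Q_min_optimal m g b j \<tau> d w)"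
    using ex by simp
  moreover have "\<forall>u. (\<forall>d\<ge>?d0. Q_max_optimal m g b j \<tau> d (u d)) \<longrightarrow>
      (\<forall>\<alpha>. (\<lambda>d. u d (\<alpha>, 1)) \<longlonglongrightarrow> ?I \<alpha>) \<and> (\<forall>d\<ge>?d0. Q_max_value m g b j \<tau> d = ereal (u d (0, 1)))"
    by (intro allI impI conjI lim max_feas Q_max_value_eq) auto
  moreover have "\<forall>w. (\<forall>d\<ge>?d0. Q_min_optimal m g b j \<tau> d (w d)) \<longrightarrow>
      (\<forall>\<alpha>. (\<lambda>d. w d (\<alpha>, 1)) \<longlonglongrightarrow> ?I \<alpha>) \<and> (\<forall>d\<ge>?d0. Q_min_value m g b j \<tau> d = ereal (w d (0, 1)))"
    by (intro allI impI conjI lim min_feas Q_min_value_eq) auto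
  moreover have "\<forall>d e. ?d0 \<le> d \<and> d \<le> e \<longrightarrow> Q_max_value m g b j \<tau> e \<le> Q_max_value m g b j \<tau> d"
    "\<forall>d e. ?d0 \<le> d \<and> d \<le> e \<longrightarrow> Q_min_value m g b j \<tau> d \<le> Q_min_value m g b j \<tau> e"
    using values_mono by simp_all
  ultimately show ?thesis
    unfolding sigma using max_lim min_lim by (intro conjI)
qed

end
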